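(* For every finite set $A\subseteq \mathbb{R}$, \[ |AA+AA|\geq |A|^{\frac{3}{2}+\frac{7}{80}-o(1)}\,. \]
   Context: $AA=\{ab: a,b\in A\}$ and $AA+AA=\{x+y: x,y\in AA\}$. The term $o(1)$ denotes a quantity tending to $0$ as $|A|\to\infty$ (uniformly over all such sets $A$). *)

theory Defs
  imports Complex_Main "HOL-Library.Set_Algebras"
begin

end

theory Submission
  imports Defs "HOL-Analysis.Convex" "HOL-Real_Asymp.Real_Asymp"
begin

text \<open>
  Write \<open>Q = AA + AA\<close>, \<open>N = |A|\<close>, and ignore logarithms.  Choose a dyadic level \<open>S\<close> of ratios \<open>b/a\<close>
  that carries most pairs of \<open>A \<times> A\<close>.  For \<open>s = b/a\<close> in \<open>S\<close> a dilate of \<open>A + sA\<close> lies in \<open>Q\<close>, so the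
  energies of \<open>A\<close> with \<open>sA\<close> are large, and the incidence bound gives a set \<open>P\<close> of \<open>p\<close> differences with
  \<open>t\<close> representations each such that \<open>p\<^sup>2t\<^sup>3 \<ge> |S|N\<^sup>8/|Q|\<^sup>3\<close>.  For \<open>x\<close> in \<open>P\<close> let \<open>A\<^sub>x = A \<inter> (A - x)\<close>.  Then
  \<open>aA + bA\<^sub>x\<close> lies in \<open>Q \<inter> (Q - bx)\<close>, so a lower bound \<open>M\<close> for typical \<open>|A + sA\<^sub>x|\<close> gives at least \<open>pNM\<close>
  incidences between the grid \<open>A \<times> Q\<close> and \<open>p|Q|\<close> lines, whence \<open>pNM\<^sup>3 \<le> |Q|\<^sup>4\<close>.  Two values of \<open>M\<close> are
  available: incidences in \<open>A\<^sub>x \<times> A\<close> give \<open>M\<^sup>2 = tN|S|\<close>, and a third moment bound for the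
  representation function of differences gives \<open>M = pt\<^sup>2/|S|\<close>.  They yield
  \<open>|S|\<^sup>4N\<^bsup>13\<^esup> \<le> |Q|\<^bsup>11\<^esup>\<close> and \<open>N\<^bsup>17\<^esup> \<le> |S||Q|\<^bsup>10\<^esup>\<close>, hence \<open>N\<^bsup>81\<^esup> \<le> |Q|\<^bsup>51\<^esup>\<close>, and \<open>81/51 > 3/2 + 7/80\<close>.

  Only grids occur as point sets, and there the Szemeredi--Trotter bound is elementary: cut the
  grid into \<open>r \<times> r\<close> cells of equal size; by monotonicity a line meets at most \<open>2r\<close> of them.
\<close>

section \<open>Incidences between lines and a grid\<close>

text \<open>Cut \<open>U\<close>, in increasing order, into blocks of \<open>d\<close> consecutive
  elements. Each element then shares its block with at most \<open>d\<close> elements, itself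
  included.\<close>

lemma monotone_cells:
  fixes U :: "'a::linorder set"
  assumes fin: "finite U" and r: "0 < r" "r \<le> card U"
  obtains f :: "'a \<Rightarrow> nat" where "mono_on U f" "\<And>u. u \<in> U \<Longrightarrow> f u < r"
    "r * card {(u, u'). u \<in> U \<and> u' \<in> U \<and> f u = f u'} \<le> 2 * (card U)\<^sup>2"
proof -
  define rank where "rank u = card {v \<in> U. v < u}" for u
  \<comment> \<open>This is |U| / r rounded up, so ranks below |U| give block indices below
    \<open>r\<close>; since \<open>r\<close> is at most |U|, rounding costs at most a factor
    2.\<close>
  define d where "d = (card U + r - 1) div r"
  define f where "f u = rank u div d" for u
  have rank_less: "rank u < rank v" if "u \<in> U" "v \<in> U" "u < v" for u v
    unfolding rank_def using that fin by (intro psubset_card_mono) auto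
  have rank_lt: "rank u < card U" if "u \<in> U" for u
    unfolding rank_def using that fin by (intro psubset_card_mono) auto
  have mono_rank: "rank u \<le> rank v" if "u \<le> v" for u v
    unfolding rank_def using that fin by (intro card_mono) auto
  have rd_lower: "card U \<le> r * d"
  proof -
    have "card U + r - 1 < r * d + r"
      unfolding d_def using r(1) by (metis add.commute dividend_less_times_div mult.commute)
    then show ?thesis using r by linarith
  qed
  have rd_upper: "r * d \<le> 2 * card U"
  proof -
    have "r * d \<le> card U + r - 1" unfolding d_def by simp
    then show ?thesis using r by linarith
  qed
  have "d > 0" using rd_lower r by (cases d) auto
  have fibre: "card {u' \<in> U. f u' = i} \<le> d" for i
  proof -
    have "inj_on rank {u' \<in> U. f u' = i}"
      by (rule inj_onI) (metis (mono_tags, lifting) mem_Collect_eq linorder_neqE rank_less less_irrefl)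
    moreover have "rank ` {u' \<in> U. f u' = i} \<subseteq> {i * d..<i * d + d}"
    proof (rule image_subsetI)
      fix x assume "x \<in> {u' \<in> U. f u' = i}"
      then have "rank x div d = i" by (simp add: f_def)
      then show "rank x \<in> {i * d..<i * d + d}"
        using \<open>d > 0\<close> dividend_less_div_times[of d "rank x"] div_times_less_eq_dividend[of "rank x" d]
        by auto
    qed
    ultimately have "card {u' \<in> U. f u' = i} \<le> card {i * d..<i * d + d}"
      by (metis card_image card_mono finite_atLeastLessThan)
    then show ?thesis by simp
  qed
  have "{(u, u'). u \<in> U \<and> u' \<in> U \<and> f u = f u'} = (SIGMA u:U. {u' \<in> U. f u' = f u})"
    by auto
  then have "card {(u, u'). u \<in> U \<and> u' \<in> U \<and> f u = f u'} = (\<Sum>u\<in>U. card {u' \<in> U. f u' = f u})"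
    using fin by simp
  also have "\<dots> \<le> (\<Sum>u\<in>U. d)" by (intro sum_mono fibre)
  also have "\<dots> = card U * d" by simp
  finally have "r * card {(u, u'). u \<in> U \<and> u' \<in> U \<and> f u = f u'} \<le> r * (card U * d)"
    by (rule mult_le_mono2)
  also have "\<dots> = card U * (r * d)" by simp
  also have "\<dots> \<le> card U * (2 * card U)" using rd_upper by (rule mult_le_mono2)
  finally have "r * card {(u, u'). u \<in> U \<and> u' \<in> U \<and> f u = f u'} \<le> 2 * (card U)\<^sup>2"
    by (simp add: power2_eq_square)
  moreover have "f u < r" if "u \<in> U" for u
    unfolding f_def using rank_lt[OF that] rd_lower by (intro less_mult_imp_div_less) simp
  moreover have "mono_on U f"
    unfolding f_def by (intro mono_onI div_le_mono mono_rank)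
  ultimately show ?thesis using that by blast
qed

text \<open>An incidence belongs to \<open>T2\<close> if its line has another incidence further left
  in the same cell, and to \<open>T1\<close> otherwise. \<open>T1\<close> has at most one incidence
  per line and cell met; \<open>T2\<close> injects into pairs of points in a common cell, because
  two points determine a line.\<close>

lemma grid_incidences_cells:
  fixes U V :: "real set" and Ls :: "(real \<times> real) set"
  assumes fin: "finite U" "finite V" "finite Ls"
    and r: "0 < r" "r \<le> card U" "r \<le> card V"
  shows "r\<^sup>2 * card {((m, c), u). (m, c) \<in> Ls \<and> u \<in> U \<and> m * u + c \<in> V}
           \<le> r\<^sup>2 * (2 * r * card Ls) + 4 * (card U * card V)\<^sup>2"
proof -
  obtain f :: "real \<Rightarrow> nat" where f: "mono_on U f" "\<And>u. u \<in> U \<Longrightarrow> f u < r"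
    "r * card {(u, u'). u \<in> U \<and> u' \<in> U \<and> f u = f u'} \<le> 2 * (card U)\<^sup>2"
    using monotone_cells[OF fin(1) r(1,2)] by blast
  obtain g :: "real \<Rightarrow> nat" where g: "mono_on V g" "\<And>v. v \<in> V \<Longrightarrow> g v < r"
    "r * card {(v, v'). v \<in> V \<and> v' \<in> V \<and> g v = g v'} \<le> 2 * (card V)\<^sup>2"
    using monotone_cells[OF fin(2) r(1,3)] by blast
  define PU where "PU = {(u, u'). u \<in> U \<and> u' \<in> U \<and> f u = f u'}"
  define PV where "PV = {(v, v'). v \<in> V \<and> v' \<in> V \<and> g v = g v'}"
  define T where "T = {((m, c), u). (m, c) \<in> Ls \<and> u \<in> U \<and> m * u + c \<in> V}"
  define same where "same m c u u' \<longleftrightarrow> u' < u \<and> ((m, c), u') \<in> T \<and>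
      f u' = f u \<and> g (m * u' + c) = g (m * u + c)" for m c u u'
  define T2 where "T2 = {((m, c), u). ((m, c), u) \<in> T \<and> (\<exists>u'. same m c u u')}"
  define T1 where "T1 = T - T2"
  have finT: "finite T"
    by (rule finite_subset[of _ "Ls \<times> U"]) (auto simp: T_def fin)
  have "PU \<subseteq> U \<times> U" "PV \<subseteq> V \<times> V" by (auto simp: PU_def PV_def)
  then have finP: "finite PU" "finite PV"
    using fin by (meson finite_SigmaI finite_subset)+
  \<comment> \<open>The cells met by a line form a chain (or an antichain, if the slope is negative), so the
    sum (or the difference) of the two cell indices identifies the cell.\<close>
  define h where "h = (\<lambda>((m, c), u). ((m, c), if m > 0 then f u + g (m * u + c) else f u + (r - g (m * u + c))))"
  have T1: "card T1 \<le> card (Ls \<times> {..<2 * r})"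
  proof (rule card_inj_on_le[of h])
    have neq: False if *: "((m, c), u) \<in> T1" "((m, c), u') \<in> T1" "h ((m, c), u) = h ((m, c), u')" "u' < u" for m c u u'
    proof -
      have in_T: "((m, c), u) \<in> T" "((m, c), u') \<in> T" and notT2: "((m, c), u) \<notin> T2"
        using * by (auto simp: T1_def)
      then have U: "u \<in> U" "u' \<in> U" "m * u + c \<in> V" "m * u' + c \<in> V" "(m, c) \<in> Ls"
        by (auto simp: T_def)
      have fu: "f u' \<le> f u" using f(1) U \<open>u' < u\<close> by (meson mono_onD less_imp_le)
      have "f u' = f u \<and> g (m * u' + c) = g (m * u + c)"
      proof (cases "m > 0")
        case True
        then have "m * u' + c \<le> m * u + c" using \<open>u' < u\<close> by simp
        then have "g (m * u' + c) \<le> g (m * u + c)" using g(1) U by (meson mono_onD)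
        then show ?thesis using *(3) True fu by (simp add: h_def)
      next
        case False
        then have "m * u + c \<le> m * u' + c" using \<open>u' < u\<close> by (simp add: mult_left_mono_neg)
        then have "g (m * u + c) \<le> g (m * u' + c)" using g(1) U by (meson mono_onD)
        \<comment> \<open>This keeps the natural-number subtraction in \<open>h\<close>
          exact.\<close>
        moreover have "g (m * u' + c) < r" using g(2) U by blast
        ultimately show ?thesis using *(3) False fu unfolding h_def by (simp; linarith)
      qed
      then have "same m c u u'" using in_T \<open>u' < u\<close> by (simp add: same_def)
      then show False using notT2 in_T by (auto simp: T2_def)
    qed
    show "inj_on h T1"
    proof (rule inj_onI)
      fix x y assume xy: "x \<in> T1" "y \<in> T1" "h x = h y"
      obtain m c u m' c' u' where eq: "x = ((m, c), u)" "y = ((m', c'), u')"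
        by (metis prod.collapse)
      then have "m' = m" "c' = c" using xy(3) by (auto simp: h_def)
      then show "x = y"
        using neq[of m c u u'] neq[of m c u' u] xy eq by (metis linorder_neqE)
    qed
    show "h ` T1 \<subseteq> Ls \<times> {..<2 * r}"
      using f(2) g(2) r(1) by (fastforce simp: h_def T1_def T_def)
    show "finite (Ls \<times> {..<2 * r})" using fin by simp
  qed
  \<comment> \<open>Records both points of the pair, coordinate by coordinate. They are distinct
    because \<open>u' < u\<close>, so slope and intercept can be recovered.\<close>
  define k where "k = (\<lambda>((m, c), u). let u' = SOME u'. same m c u u' in ((u, u'), (m * u + c, m * u' + c)))"
  have T2: "card T2 \<le> card (PU \<times> PV)"
  proof (rule card_inj_on_le[of k])
    have some: "same m c u (SOME u'. same m c u u')" if "((m, c), u) \<in> T2" for m c u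
    proof -
      obtain u' where "same m c u u'" using \<open>((m, c), u) \<in> T2\<close> by (auto simp: T2_def)
      then show ?thesis by (rule someI)
    qed
    show "inj_on k T2"
    proof (rule inj_onI)
      fix x y assume xy: "x \<in> T2" "y \<in> T2" "k x = k y"
      obtain m c u m' c' v where eq: "x = ((m, c), u)" "y = ((m', c'), v)"
        by (metis prod.collapse)
      define u' where "u' = (SOME u'. same m c u u')"
      have lt: "u' < u" using some[of m c u] xy eq by (simp add: u'_def same_def)
      have e: "v = u" "m * u + c = m' * u + c'" "m * u' + c = m' * u' + c'"
        using xy(3) eq unfolding k_def u'_def by (auto simp: Let_def)
      then have "(m - m') * (u - u') = 0" by (simp add: algebra_simps)
      then have "m = m'" using lt by simp
      then show "x = y" using e eq by simp
    qed
    show "k ` T2 \<subseteq> PU \<times> PV"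
    proof (rule image_subsetI)
      fix x assume x: "x \<in> T2"
      obtain m c u where eq: "x = ((m, c), u)" by (metis prod.collapse)
      have "same m c u (SOME u'. same m c u u')" "((m, c), u) \<in> T"
        using some[of m c u] x eq by (auto simp: T2_def)
      then show "k x \<in> PU \<times> PV"
        by (auto simp: eq k_def Let_def same_def T_def PU_def PV_def)
    qed
    show "finite (PU \<times> PV)" using finP by simp
  qed
  have "card T \<le> card T1 + card T2"
  proof -
    have "T = T1 \<union> T2" by (auto simp: T1_def T2_def)
    then show ?thesis using card_Un_le[of T1 T2] by simp
  qed
  also have "\<dots> \<le> 2 * r * card Ls + card PU * card PV"
    using T1 T2 by (simp add: card_cartesian_product mult.commute)
  finally have "r\<^sup>2 * card T \<le> r\<^sup>2 * (2 * r * card Ls + card PU * card PV)"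
    by (rule mult_le_mono2)
  also have "\<dots> = r\<^sup>2 * (2 * r * card Ls) + (r * card PU) * (r * card PV)"
    by (simp add: algebra_simps power2_eq_square)
  also have "(r * card PU) * (r * card PV) \<le> (2 * (card U)\<^sup>2) * (2 * (card V)\<^sup>2)"
    using f(3) g(3) unfolding PU_def PV_def by (rule mult_le_mono)
  finally show ?thesis by (simp add: T_def power_mult_distrib)
qed

text \<open>With \<open>r\<close> close to I / (4 |Ls|) the one-per-cell term is at most I / 2, so
  the pair term dominates. This \<open>r\<close> is admissible by the trivial bounds I \<le> |U|
  |Ls| and I \<le> |V| |Ls|, the second of which uses nonzero slopes; the first alternative disposes
  of \<open>I\<close> too small for a positive \<open>r\<close>.\<close>

lemma grid_incidences:
  fixes U V :: "real set" and Ls :: "(real \<times> real) set"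
  assumes fin: "finite U" "finite V" "finite Ls"
    and slope: "\<And>m c. (m, c) \<in> Ls \<Longrightarrow> m \<noteq> 0"
  defines "I \<equiv> card {((m, c), u). (m, c) \<in> Ls \<and> u \<in> U \<and> m * u + c \<in> V}"
  shows "I \<le> 4 * card Ls \<or> I ^ 3 \<le> 512 * (card U * card V * card Ls)\<^sup>2"
proof (cases "I \<le> 4 * card Ls")
  case False
  then have big: "4 * card Ls < I" by simp
  define T where "T = {((m, c), u). (m, c) \<in> Ls \<and> u \<in> U \<and> m * u + c \<in> V}"
  have "T \<subseteq> Ls \<times> U" by (auto simp: T_def)
  then have "card T \<le> card (Ls \<times> U)" using fin by (intro card_mono) auto
  then have IU: "I \<le> card U * card Ls" by (simp add: I_def T_def card_cartesian_product mult.commute)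
  have "card T \<le> card (Ls \<times> V)"
  proof (rule card_inj_on_le[of "\<lambda>((m, c), u). ((m, c), m * u + c)"])
    show "inj_on (\<lambda>((m, c), u). ((m, c), m * u + c)) T"
      using slope by (auto simp: inj_on_def T_def)
  qed (use fin in \<open>auto simp: T_def\<close>)
  then have IV: "I \<le> card V * card Ls" by (simp add: I_def T_def card_cartesian_product mult.commute)
  have "I > 0" using big by simp
  then have l0: "card Ls > 0" using IU by (cases "card Ls") auto
  define r where "r = I div (4 * card Ls)"
  have r0: "r > 0" unfolding r_def using big l0 by (simp add: div_greater_zero_iff)
  have r_le: "r * (4 * card Ls) \<le> I" unfolding r_def by (rule div_times_less_eq_dividend)
  have r_ge: "I \<le> 8 * r * card Ls"
  proof -
    have "I < r * (4 * card Ls) + 4 * card Ls"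
      unfolding r_def using l0 dividend_less_div_times[of "4 * card Ls" I] by linarith
    also have "\<dots> \<le> 8 * r * card Ls" using r0 by (cases r) (auto simp: algebra_simps)
    finally show ?thesis by simp
  qed
  have "r * card Ls \<le> card U * card Ls" "r * card Ls \<le> card V * card Ls"
    using r_le IU IV by linarith+
  then have rUV: "r \<le> card U" "r \<le> card V" using l0 by auto
  have "r\<^sup>2 * I \<le> r\<^sup>2 * (2 * r * card Ls) + 4 * (card U * card V)\<^sup>2"
    unfolding I_def by (rule grid_incidences_cells[OF fin r0 rUV])
  moreover have "r\<^sup>2 * (2 * (2 * r * card Ls)) \<le> r\<^sup>2 * I"
    using r_le by (intro mult_le_mono2) (simp add: mult_ac)
  ultimately have main: "r\<^sup>2 * I \<le> 8 * (card U * card V)\<^sup>2" by linarith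
  have "I ^ 3 = I\<^sup>2 * I" by (simp add: power2_eq_square power3_eq_cube)
  also have "\<dots> \<le> (8 * r * card Ls)\<^sup>2 * I"
    using r_ge by (intro mult_le_mono1 power_mono) auto
  also have "\<dots> = 64 * (card Ls)\<^sup>2 * (r\<^sup>2 * I)" by (simp add: power_mult_distrib mult_ac)
  also have "\<dots> \<le> 64 * (card Ls)\<^sup>2 * (8 * (card U * card V)\<^sup>2)"
    using main by (rule mult_le_mono2)
  finally show ?thesis
    by (simp add: power_mult_distrib mult_ac)
qed simp

text \<open>Serves the double sums below: a triple \<open>(u, m, c)\<close> is an incidence of the
  line of slope \<open>m\<close> and intercept \<open>c\<close> with the grid
  \<open>U \<times> V\<close>.\<close>

lemma product_incidences:
  fixes U V M C :: "real set"
  assumes fin: "finite U" "finite V" "finite M" "finite C" and M: "0 \<notin> M"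
  defines "J \<equiv> \<Sum>u\<in>U. \<Sum>m\<in>M. real (card {c \<in> C. c + u * m \<in> V})"
  shows "J \<le> 4 * (real (card M) * real (card C)) \<or>
    J ^ 3 \<le> 512 * (real (card U) * real (card V) * (real (card M) * real (card C)))\<^sup>2"
proof -
  define T where "T = {((m, c), u). (m, c) \<in> M \<times> C \<and> u \<in> U \<and> m * u + c \<in> V}"
  have "bij_betw (\<lambda>(u, m, c). ((m, c), u)) (SIGMA u:U. SIGMA m:M. {c \<in> C. c + u * m \<in> V}) T"
    by (rule bij_betwI[of _ _ _ "\<lambda>((m, c), u). (u, m, c)"]) (auto simp: T_def algebra_simps)
  then have "card T = card (SIGMA u:U. SIGMA m:M. {c \<in> C. c + u * m \<in> V})"
    by (rule bij_betw_same_card[symmetric])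
  also have "\<dots> = (\<Sum>u\<in>U. \<Sum>m\<in>M. card {c \<in> C. c + u * m \<in> V})"
    using fin by simp
  finally have J: "J = real (card T)" by (simp add: J_def)
  have "card T \<le> 4 * card (M \<times> C) \<or> card T ^ 3 \<le> 512 * (card U * card V * card (M \<times> C))\<^sup>2"
    unfolding T_def using fin M by (intro grid_incidences) auto
  then show ?thesis
  proof
    assume "card T \<le> 4 * card (M \<times> C)"
    then have "real (card T) \<le> real (4 * card (M \<times> C))" by (rule of_nat_mono)
    then show ?thesis by (simp add: J card_cartesian_product)
  next
    assume "card T ^ 3 \<le> 512 * (card U * card V * card (M \<times> C))\<^sup>2"
    then have "real (card T ^ 3) \<le> real (512 * (card U * card V * card (M \<times> C))\<^sup>2)"
      by (rule of_nat_mono)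
    then show ?thesis by (simp add: J card_cartesian_product)
  qed
qed

section \<open>Dyadic levels, collisions and differences\<close>

text \<open>Averaging: each element lies in one of the \<open>k\<close> dyadic levels, so if every
  level carried less than a \<open>k\<close>-th part of the weight, the total would fall
  short.\<close>

lemma dyadic_level:
  fixes w :: "'a \<Rightarrow> real" and f :: "'a \<Rightarrow> nat"
  assumes fin: "finite X" and w: "\<And>x. x \<in> X \<Longrightarrow> 0 \<le> w x"
    and f: "\<And>x. x \<in> X \<Longrightarrow> 1 \<le> f x \<and> f x < 2 ^ k"
  shows "\<exists>j. sum w X \<le> real k * sum w {x \<in> X. 2 ^ j \<le> f x \<and> f x < 2 ^ (j + 1)}"
proof (rule ccontr)
  define s where "s j = sum w {x \<in> X. 2 ^ j \<le> f x \<and> f x < 2 ^ (j + 1)}" for j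
  assume "\<not> ?thesis"
  then have less: "real k * s j < sum w X" for j by (auto simp: s_def not_le)
  have "k > 0"
  proof (rule ccontr)
    assume "\<not> k > 0"
    then have "X = {}" using f by fastforce
    then show False using less[of 0] \<open>\<not> k > 0\<close> by simp
  qed
  have "sum w X \<le> (\<Sum>x\<in>X. \<Sum>j<k. if 2 ^ j \<le> f x \<and> f x < 2 ^ (j + 1) then w x else 0)"
  proof (rule sum_mono)
    fix x assume x: "x \<in> X"
    obtain j where j: "2 ^ j \<le> f x" "f x < 2 ^ (j + 1)"
      using ex_power_ivl1[of 2 "f x"] f[OF x] by auto
    have "(2::nat) ^ j < 2 ^ k" using j f[OF x] by linarith
    then have "j < k" by simp
    then have "(if 2 ^ j \<le> f x \<and> f x < 2 ^ (j + 1) then w x else 0)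
        \<le> (\<Sum>j<k. if 2 ^ j \<le> f x \<and> f x < 2 ^ (j + 1) then w x else 0)"
      using w[OF x] by (intro member_le_sum) auto
    then show "w x \<le> (\<Sum>j<k. if 2 ^ j \<le> f x \<and> f x < 2 ^ (j + 1) then w x else 0)"
      using j by simp
  qed
  also have "\<dots> = (\<Sum>j<k. s j)"
    unfolding s_def by (subst sum.swap) (simp add: sum.inter_filter fin)
  finally have le: "sum w X \<le> (\<Sum>j<k. s j)" .
  have "real k * (\<Sum>j<k. s j) = (\<Sum>j<k. real k * s j)" by (rule sum_distrib_left)
  also have "\<dots> < (\<Sum>j<k. sum w X)"
    using \<open>k > 0\<close> less by (intro sum_strict_mono) auto
  also have "\<dots> = real k * sum w X" by simp
  finally show False using le \<open>k > 0\<close> by simp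
qed

text \<open>Cauchy-Schwarz over the fibres of \<open>f\<close>: their sizes add up to |X|, the
  squares of the sizes to the number of colliding pairs.\<close>

lemma card_square_le_collisions:
  assumes fin: "finite X"
  shows "(real (card X))\<^sup>2 \<le> real (card (f ` X)) * real (card {(x, y). x \<in> X \<and> y \<in> X \<and> f x = f y})"
proof -
  define c where "c z = real (card {x \<in> X. f x = z})" for z
  have X: "real (card X) = (\<Sum>z\<in>f ` X. c z)"
    using sum.image_gen[OF fin, of "\<lambda>_. 1::real" f] by (simp add: c_def)
  have "{(x, y). x \<in> X \<and> y \<in> X \<and> f x = f y} = (SIGMA x:X. {y \<in> X. f y = f x})" by auto
  then have "real (card {(x, y). x \<in> X \<and> y \<in> X \<and> f x = f y}) = (\<Sum>x\<in>X. c (f x))"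
    using fin by (simp add: c_def)
  also have "\<dots> = (\<Sum>z\<in>f ` X. \<Sum>x | x \<in> X \<and> f x = z. c (f x))"
    by (rule sum.image_gen[OF fin])
  also have "\<dots> = (\<Sum>z\<in>f ` X. (c z)\<^sup>2)"
  proof (rule sum.cong)
    fix z
    have "(\<Sum>x | x \<in> X \<and> f x = z. c (f x)) = (\<Sum>x | x \<in> X \<and> f x = z. c z)"
      by (rule sum.cong) auto
    then show "(\<Sum>x | x \<in> X \<and> f x = z. c (f x)) = (c z)\<^sup>2"
      by (simp add: c_def power2_eq_square)
  qed simp
  finally have pairs: "real (card {(x, y). x \<in> X \<and> y \<in> X \<and> f x = f y}) = (\<Sum>z\<in>f ` X. (c z)\<^sup>2)" .
  show ?thesis
    using sum_squared_le_sum_of_squares[of c "f ` X"] fin unfolding X pairs by (simp add: mult.commute)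
qed

section \<open>Representations of differences, and sums with a dilate\<close>

text \<open>This is \<open>B \<inter> (B - x)\<close>; its size counts the representations of
  \<open>x\<close> as a difference of two elements of \<open>B\<close>.\<close>

definition reps :: "real set \<Rightarrow> real \<Rightarrow> real set" where
  "reps B x = {b \<in> B. b + x \<in> B}"

definition dilate_sum :: "real set \<Rightarrow> real \<Rightarrow> real set \<Rightarrow> real set" where
  "dilate_sum B d C = (\<lambda>(b, c). b + d * c) ` (B \<times> C)"

definition difference_set :: "real set \<Rightarrow> real set" where
  "difference_set B = (\<lambda>(b, c). c - b) ` (B \<times> B)"

lemma finite_reps [simp]: "finite B \<Longrightarrow> finite (reps B x)"
  by (simp add: reps_def)

lemma card_reps_le: "finite B \<Longrightarrow> card (reps B x) \<le> card B"
  by (auto simp: reps_def intro: card_mono)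

lemma finite_difference_set [simp]: "finite B \<Longrightarrow> finite (difference_set B)"
  by (simp add: difference_set_def)

lemma finite_dilate_sum [simp]: "finite B \<Longrightarrow> finite C \<Longrightarrow> finite (dilate_sum B d C)"
  by (simp add: dilate_sum_def)

lemma reps_zero [simp]: "reps B 0 = B"
  by (simp add: reps_def)

lemma card_reps_pos: "finite B \<Longrightarrow> x \<in> difference_set B \<Longrightarrow> 1 \<le> card (reps B x)"
  by (auto simp: difference_set_def reps_def Suc_le_eq card_gt_0_iff)

lemma sum_card_reps_le:
  assumes "finite B" "finite P"
  shows "(\<Sum>x\<in>P. card (reps B x)) \<le> (card B)\<^sup>2"
proof -
  have "card (SIGMA x:P. reps B x) \<le> card (B \<times> B)"
    by (rule card_inj_on_le[of "\<lambda>(x, b). (b, b + x)"])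
      (use assms in \<open>auto simp: inj_on_def reps_def\<close>)
  then show ?thesis using assms by (simp add: card_cartesian_product power2_eq_square)
qed

text \<open>A collision b + dc = b' + dc' says b - b' = d(c' - c); with y = c' - c it is a
  representation of \<open>y\<close> in \<open>C\<close> together with one of \<open>d * y\<close>
  in \<open>B\<close>. By Cauchy-Schwarz, few sums force many collisions.\<close>

lemma dilate_sum_energy:
  assumes fin: "finite B" and C: "C \<subseteq> B"
  shows "(real (card B) * real (card C))\<^sup>2 \<le> real (card (dilate_sum B d C)) *
    (\<Sum>y\<in>difference_set B. real (card (reps C y)) * real (card (reps B (d * y))))"
proof -
  define E where "E = {(p, p'). p \<in> B \<times> C \<and> p' \<in> B \<times> C \<and>
    (\<lambda>(b, c). b + d * c) p = (\<lambda>(b, c). b + d * c) p'}"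
  have finC: "finite C" using fin C by (rule finite_subset[rotated])
  have "(real (card (B \<times> C)))\<^sup>2 \<le> real (card (dilate_sum B d C)) * real (card E)"
    unfolding dilate_sum_def E_def using fin finC by (intro card_square_le_collisions) simp
  moreover have "card E \<le> card (SIGMA y:difference_set B. reps C y \<times> reps B (d * y))"
  proof (rule card_inj_on_le[of "\<lambda>((b, c), (b', c')). (c' - c, (c, b'))"])
    show "inj_on (\<lambda>((b, c), (b', c')). (c' - c, (c, b'))) E"
      by (auto simp: inj_on_def E_def)
    show "(\<lambda>((b, c), (b', c')). (c' - c, (c, b'))) ` E \<subseteq> (SIGMA y:difference_set B. reps C y \<times> reps B (d * y))"
    proof clarsimp
      fix b c b' c' assume "((b, c), (b', c')) \<in> E"
      then have *: "b \<in> B" "b' \<in> B" "c \<in> C" "c' \<in> C" "b + d * c = b' + d * c'"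
        by (auto simp: E_def)
      have "b' + d * (c' - c) = b" using *(5) by (simp add: algebra_simps)
      then show "c' - c \<in> difference_set B \<and> c \<in> reps C (c' - c) \<and> b' \<in> reps B (d * (c' - c))"
        using * C by (auto simp: difference_set_def reps_def)
    qed
  qed (use fin finC in auto)
  moreover have "card (SIGMA y:difference_set B. reps C y \<times> reps B (d * y)) =
      (\<Sum>y\<in>difference_set B. card (reps C y) * card (reps B (d * y)))"
    using fin finC by (simp add: card_cartesian_product)
  ultimately have "(real (card (B \<times> C)))\<^sup>2 \<le> real (card (dilate_sum B d C)) *
      real (\<Sum>y\<in>difference_set B. card (reps C y) * card (reps B (d * y)))"
    by (metis (no_types, lifting) mult_left_mono of_nat_0_le_iff of_nat_mono order_trans)
  then show ?thesis by (simp add: card_cartesian_product)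
qed

text \<open>If \<open>b\<close> is counted on the left, then \<open>b\<close> and
  \<open>b + x\<close> both lie in \<open>reps B y\<close>, and they determine \<open>x\<close>.
  This turns a sum of energies of the sets \<open>reps B x\<close> into a third moment for
  \<open>B\<close>.\<close>

lemma sum_card_reps_reps_le:
  assumes "finite B" "finite P"
  shows "(\<Sum>x\<in>P. card (reps (reps B x) y)) \<le> (card (reps B y))\<^sup>2"
proof -
  have "card (SIGMA x:P. reps (reps B x) y) \<le> card (reps B y \<times> reps B y)"
    by (rule card_inj_on_le[of "\<lambda>(x, b). (b, b + x)"])
      (use assms in \<open>auto simp: inj_on_def reps_def algebra_simps\<close>)
  then show ?thesis using assms by (simp add: card_cartesian_product power2_eq_square)
qed

section \<open>Sets with a popular level of ratios\<close>

text \<open>\<open>S\<close> is a set of ratios \<open>s\<close> with at least \<open>\<tau>\<close> representations each, which together account for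
  \<open>N\<^sup>2\<close> pairs in \<open>A \<times> A\<close> up to a logarithmic factor, and the elements of \<open>B\<close> take part in
  many of these pairs.  Powers of \<open>L\<close>, which is of logarithmic size, absorb all constants and losses
  of dyadic pigeonholing; this is also why \<open>L\<close> has the lower bound \<open>2048\<close>.\<close>

locale ratio_structure =
  fixes A B S :: "real set" and L \<tau> :: real and k :: nat
  assumes finA: "finite A" and A0: "0 \<notin> A" and BA: "B \<subseteq> A"
    and finS: "finite S" and S0: "0 \<notin> S"
    and L: "2048 \<le> L" "real k \<le> L" and k: "card A < 2 ^ k"
    and deg: "\<And>b. b \<in> B \<Longrightarrow> real (card A) \<le> L\<^sup>2 * real (card {c \<in> A. b / c \<in> S})"
    and cardB: "real (card A) \<le> L\<^sup>2 * real (card B)"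
    and rep: "\<And>s. s \<in> S \<Longrightarrow> \<tau> \<le> real (card {a \<in> A. s * a \<in> A})"
    and pop: "(real (card A))\<^sup>2 \<le> 2 * L * \<tau> * real (card S)"
    and large: "L ^ 1000 \<le> real (card A)"
    and small: "real (card (A * A + A * A)) ^ 5 \<le> real (card A) ^ 8"
begin

abbreviation "N \<equiv> real (card A)"
abbreviation "n \<equiv> real (card B)"
abbreviation "\<sigma> \<equiv> real (card S)"
abbreviation "Q \<equiv> A * A + A * A"
abbreviation "q \<equiv> real (card Q)"
abbreviation "r x \<equiv> real (card (reps B x))"

section \<open>Size relations between the parameters\<close>

lemma finB: "finite B"
  using finA BA by (rule finite_subset[rotated])

lemma finQ: "finite Q"
  using finA by (simp add: finite_set_times finite_set_plus)

lemma L_pos: "0 < L"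
  using L by simp

lemma N_pos: "0 < N"
  using large L_pos by (metis zero_less_power less_le_trans)

lemma n_pos: "0 < n"
  using cardB N_pos by (metis mult_zero_right less_le_trans of_nat_0_less_iff neq0_conv of_nat_0 less_irrefl)

lemma n_le_N: "n \<le> N"
  using card_mono[OF finA BA] by simp

lemma tau_sigma_pos: "0 < \<tau> * \<sigma>"
proof -
  have "0 < N\<^sup>2" using N_pos by simp
  also note pop
  finally have "0 < 2 * L * (\<tau> * \<sigma>)" by (simp add: mult.assoc)
  then show ?thesis using L_pos by (simp add: zero_less_mult_iff)
qed

lemma sigma_pos: "0 < \<sigma>" and tau_pos: "0 < \<tau>"
  using tau_sigma_pos by (auto simp: zero_less_mult_iff)

lemma tau_le_N: "\<tau> \<le> N"
proof -
  obtain s where "s \<in> S" using sigma_pos by (metis card_gt_0_iff of_nat_0_less_iff equals0I)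
  moreover have "card {a \<in> A. s * a \<in> A} \<le> card A" using finA by (intro card_mono) auto
  ultimately show ?thesis using rep[of s] by simp
qed

lemma N_le_sigma: "N \<le> 2 * L * \<sigma>"
proof -
  have "N * N \<le> 2 * L * \<sigma> * \<tau>" using pop by (simp add: power2_eq_square mult_ac)
  also have "\<dots> \<le> 2 * L * \<sigma> * N" using tau_le_N L_pos by (intro mult_left_mono) auto
  finally show ?thesis using N_pos by simp
qed

lemma q_pos: "0 < q"
proof -
  obtain a where "a \<in> A" using N_pos by (metis card_gt_0_iff of_nat_0_less_iff equals0I)
  then have "a * a + a * a \<in> Q" by (intro set_plus_intro set_times_intro)
  then show ?thesis using finQ by (auto simp: card_gt_0_iff)
qed

lemma r_le_N: "r x \<le> N"
  using card_reps_le[OF finB, of x] n_le_N by linarith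

lemma r_lt: "card (reps B x) < 2 ^ k"
  using r_le_N[of x] k by linarith

text \<open>Inequalities between monomials are treated below as linear inequalities between
  logarithms, with these facts as shared input: \<open>ln L\<close> absorbs constants, and
  \<open>ln N\<close> absorbs bounded powers of \<open>L\<close>.\<close>

lemma ln_bounds:
  "ln N \<le> 2 * ln L + ln n" "ln n \<le> ln N" "ln N \<le> ln 2 + ln L + ln \<sigma>"
  "5 * ln q \<le> 8 * ln N" "1000 * ln L \<le> ln N" "11 * ln 2 \<le> ln L" "0 < ln (2::real)"
proof -
  have "ln N \<le> ln (L\<^sup>2 * n)" using cardB N_pos by (intro ln_mono) auto
  then show "ln N \<le> 2 * ln L + ln n" using L_pos n_pos by (simp add: ln_mult ln_realpow)
  show "ln n \<le> ln N" using n_le_N n_pos by (intro ln_mono) auto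
  have "ln N \<le> ln (2 * L * \<sigma>)" using N_le_sigma N_pos by (intro ln_mono) auto
  then show "ln N \<le> ln 2 + ln L + ln \<sigma>" using L_pos sigma_pos by (simp add: ln_mult)
  have "ln (q ^ 5) \<le> ln (N ^ 8)" using small q_pos by (intro ln_mono) auto
  then show "5 * ln q \<le> 8 * ln N" by (simp add: ln_realpow)
  have "ln (L ^ 1000) \<le> ln N" using large L_pos by (intro ln_mono) auto
  then show "1000 * ln L \<le> ln N" by (simp add: ln_realpow)
  have "ln (2 ^ 11) \<le> ln L" using L by (intro ln_mono) auto
  then show "11 * ln 2 \<le> ln L" by (subst (asm) ln_realpow) simp
qed simp

text \<open>Multiplication by \<open>a\<close> sends b + sc to ab + (sa)c with \<open>s * a\<close>
  in \<open>A\<close>; the further shift by sax replaces c by c + x, which is again in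
  \<open>A\<close>.\<close>

lemma dilate_sum_shift:
  assumes "s \<in> S" "a \<in> A" "s * a \<in> A"
  shows "card (dilate_sum B s (reps B x)) \<le> card {v \<in> Q. v + s * a * x \<in> Q}"
proof (rule card_inj_on_le[of "(*) a"])
  show "inj_on ((*) a) (dilate_sum B s (reps B x))"
    using assms A0 by (auto simp: inj_on_def)
  show "(*) a ` dilate_sum B s (reps B x) \<subseteq> {v \<in> Q. v + s * a * x \<in> Q}"
  proof (clarsimp simp: dilate_sum_def)
    fix b c assume "b \<in> B" "c \<in> reps B x"
    then have *: "b \<in> A" "c \<in> A" "c + x \<in> A" using BA by (auto simp: reps_def)
    have "a * (b + s * c) = a * b + s * a * c" "a * (b + s * c) + s * a * x = a * b + s * a * (c + x)"
      by (simp_all add: algebra_simps)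
    then show "a * (b + s * c) \<in> Q \<and> a * (b + s * c) + s * a * x \<in> Q"
      using assms * by (metis set_plus_intro set_times_intro)
  qed
  show "finite {v \<in> Q. v + s * a * x \<in> Q}" using finQ by simp
qed

lemma card_dilate_sum_le: 
  assumes "s \<in> S" shows "real (card (dilate_sum B s B)) \<le> q"
proof -
  have "0 < card {a \<in> A. s * a \<in> A}" using rep[OF assms] tau_pos by linarith
  then have "{a \<in> A. s * a \<in> A} \<noteq> {}" by (metis card_gt_0_iff)
  then obtain a where "a \<in> A" "s * a \<in> A" by auto
  then have "card (dilate_sum B s (reps B 0)) \<le> card Q"
    using dilate_sum_shift[OF assms, of a 0] by simp
  then show ?thesis by simp
qed

text \<open>A pair b, b + sy in \<open>B\<close> is an incidence of the line of slope
  \<open>y\<close> and intercept b with the grid \<open>S \<times> B\<close>.\<close>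

lemma dilate_incidences:
  assumes "finite Y" "0 \<notin> Y"
  defines "H \<equiv> \<Sum>s\<in>S. \<Sum>y\<in>Y. r (s * y)"
  shows "H \<le> 4 * (real (card Y) * n) \<or> H ^ 3 \<le> 512 * (\<sigma> * n * (real (card Y) * n))\<^sup>2"
  using product_incidences[OF finS finB assms(1) finB assms(2)]
  unfolding H_def reps_def .

section \<open>Popular differences and the third moment\<close>

text \<open>For each \<open>s\<close> in \<open>S\<close> the sum B + sB has at most
  \<open>q\<close> elements, so its energy is at least n^4 / q. Summed over \<open>S\<close> and
  restricted to a dyadic level \<open>P\<close> of \<open>r\<close>, the energy is about t H, and
  the incidence bound for \<open>H\<close> forces |P|^2 t^3 to be large.\<close>

lemma popular_differences:
  obtains t P where "1 \<le> t" "finite P" "0 \<notin> P" "P \<noteq> {}" "\<And>x. x \<in> P \<Longrightarrow> t \<le> r x"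
    "t * real (card P) \<le> N\<^sup>2" "\<sigma> * N ^ 8 \<le> L ^ 22 * q ^ 3 * t ^ 3 * (real (card P))\<^sup>2"
proof -
  define X where "X = difference_set B - {0}"
  define w where "w x = r x * (\<Sum>s\<in>S. r (s * x))" for x
  have finX: "finite X" using finB by (simp add: X_def)
  \<comment> \<open>Ensures that the trivial difference 0, which contributes q n^2, accounts for at
    most half of n^4.\<close>
  have qn: "2 * q \<le> n\<^sup>2"
  proof -
    have "ln 2 + ln q \<le> 2 * ln n" using ln_bounds by argo
    then have "ln (2 * q) \<le> ln (n\<^sup>2)" using q_pos by (simp add: ln_mult ln_realpow)
    then show ?thesis using q_pos n_pos by simp
  qed
  have one: "n ^ 4 \<le> 2 * q * (\<Sum>x\<in>X. r x * r (s * x))" if "s \<in> S" for s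
  proof -
    have "0 \<in> difference_set B" using n_pos unfolding difference_set_def by (force simp: card_gt_0_iff)
    then have split: "(\<Sum>x\<in>difference_set B. r x * r (s * x)) = n * n + (\<Sum>x\<in>X. r x * r (s * x))"
      unfolding X_def by (subst sum.remove[of _ 0]) (use finB in auto)
    have "(n * n)\<^sup>2 \<le> real (card (dilate_sum B s B)) * (\<Sum>x\<in>difference_set B. r x * r (s * x))"
      by (rule dilate_sum_energy[OF finB subset_refl])
    also have "\<dots> \<le> q * (\<Sum>x\<in>difference_set B. r x * r (s * x))"
      by (intro mult_right_mono card_dilate_sum_le[OF that] sum_nonneg) auto
    finally have "n ^ 4 \<le> q * n\<^sup>2 + q * (\<Sum>x\<in>X. r x * r (s * x))"
      unfolding split by (simp add: algebra_simps power2_eq_square power4_eq_xxxx)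
    moreover have "2 * q * n\<^sup>2 \<le> n\<^sup>2 * n\<^sup>2" using qn by (intro mult_right_mono) auto
    moreover have "n\<^sup>2 * n\<^sup>2 = n ^ 4" by simp
    ultimately show ?thesis by linarith
  qed
  have "\<sigma> * n ^ 4 = (\<Sum>s\<in>S. n ^ 4)" by simp
  also have "\<dots> \<le> (\<Sum>s\<in>S. 2 * q * (\<Sum>x\<in>X. r x * r (s * x)))" by (intro sum_mono one)
  also have "\<dots> = 2 * q * (\<Sum>s\<in>S. \<Sum>x\<in>X. r x * r (s * x))" by (simp add: sum_distrib_left)
  also have "(\<Sum>s\<in>S. \<Sum>x\<in>X. r x * r (s * x)) = sum w X"
    unfolding w_def by (subst sum.swap) (simp add: sum_distrib_left)
  finally have lower: "\<sigma> * n ^ 4 \<le> 2 * q * sum w X" .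
  have w0: "0 \<le> w x" for x unfolding w_def by (intro mult_nonneg_nonneg sum_nonneg) auto
  have levels: "1 \<le> card (reps B x) \<and> card (reps B x) < 2 ^ k" if "x \<in> X" for x
    using that card_reps_pos[OF finB] r_lt by (auto simp: X_def)
  obtain j where j: "sum w X \<le> real k * sum w {x \<in> X. 2 ^ j \<le> card (reps B x) \<and> card (reps B x) < 2 ^ (j + 1)}"
    using dyadic_level[OF finX, of w "\<lambda>x. card (reps B x)" k] w0 levels by blast
  define P where "P = {x \<in> X. 2 ^ j \<le> card (reps B x) \<and> card (reps B x) < 2 ^ (j + 1)}"
  define t where "t = (2::real) ^ j"
  have t1: "1 \<le> t" by (simp add: t_def)
  have finP: "finite P" and P0: "0 \<notin> P" using finX by (auto simp: P_def X_def)
  have tr: "t \<le> r x" "r x \<le> 2 * t" if "x \<in> P" for x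
  proof -
    have "2 ^ j \<le> card (reps B x)" "card (reps B x) \<le> 2 ^ (j + 1)" using that by (auto simp: P_def)
    then have "real (2 ^ j) \<le> r x" "r x \<le> real (2 ^ (j + 1))" by (simp_all only: of_nat_le_iff)
    then show "t \<le> r x" "r x \<le> 2 * t" by (simp_all add: t_def)
  qed
  define H where "H = (\<Sum>s\<in>S. \<Sum>y\<in>P. r (s * y))"
  have H0: "0 \<le> H" by (auto simp: H_def intro!: sum_nonneg)
  have "sum w P \<le> (\<Sum>x\<in>P. 2 * t * (\<Sum>s\<in>S. r (s * x)))"
    unfolding w_def using tr by (intro sum_mono mult_right_mono sum_nonneg) auto
  also have "\<dots> = 2 * t * H" unfolding H_def by (subst sum.swap) (simp add: sum_distrib_left)
  finally have wP: "sum w P \<le> 2 * t * H" .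
  have "0 \<le> 2 * t * H" using t1 H0 by simp
  have "sum w X \<le> real k * sum w P" using j by (simp add: P_def)
  also have "\<dots> \<le> real k * (2 * t * H)" using wP by (intro mult_left_mono) auto
  also have "\<dots> \<le> L * (2 * t * H)" using \<open>0 \<le> 2 * t * H\<close> L by (intro mult_right_mono) auto
  finally have "2 * q * sum w X \<le> 2 * q * (L * (2 * t * H))" using q_pos by (intro mult_left_mono) auto
  with lower have main: "\<sigma> * n ^ 4 \<le> 4 * L * q * t * H" by (simp add: mult_ac)
  have "0 < \<sigma> * n ^ 4" using sigma_pos n_pos by simp
  then have "H \<noteq> 0" using main by auto
  then have Hpos: "0 < H" using H0 by simp
  have Pne: "P \<noteq> {}" using \<open>H \<noteq> 0\<close> by (auto simp: H_def)
  then have p_pos: "0 < real (card P)" using finP by (simp add: card_gt_0_iff)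
  have ptn: "t * real (card P) \<le> N\<^sup>2"
  proof -
    have "t * real (card P) = (\<Sum>x\<in>P. t)" by simp
    also have "\<dots> \<le> (\<Sum>x\<in>P. r x)" using tr by (intro sum_mono) auto
    also have "\<dots> \<le> real ((card B)\<^sup>2)"
      using sum_card_reps_le[OF finB finP] by (metis of_nat_mono of_nat_sum)
    also have "\<dots> \<le> N\<^sup>2" using n_le_N by (simp add: power_mono)
    finally show ?thesis .
  qed
  have "ln (\<sigma> * n ^ 4) \<le> ln (4 * L * q * t * H)" using main \<open>0 < \<sigma> * n ^ 4\<close> by (intro ln_mono) auto
  then have lmain: "ln \<sigma> + 4 * ln n \<le> 2 * ln 2 + ln L + ln q + ln t + ln H"
    using sigma_pos n_pos L_pos q_pos t1 Hpos ln_realpow[of 2 2] by (simp add: ln_mult ln_realpow)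
  have "ln (t * real (card P)) \<le> ln (N\<^sup>2)" using ptn t1 p_pos by (intro ln_mono) auto
  then have lptn: "ln t + ln (real (card P)) \<le> 2 * ln N"
    using t1 p_pos by (simp add: ln_mult ln_realpow)
  have H3: "H ^ 3 \<le> 512 * (\<sigma> * n * (real (card P) * n))\<^sup>2"
  proof -
    have "H \<le> 4 * (real (card P) * n) \<or> H ^ 3 \<le> 512 * (\<sigma> * n * (real (card P) * n))\<^sup>2"
      unfolding H_def by (rule dilate_incidences[OF finP P0])
    \<comment> \<open>Since t |P| \<le> N^2, the linear alternative would make \<open>q\<close> at
      least N^2 up to powers of \<open>L\<close>, against q^5 \<le> N^8.\<close>
    moreover have False if "H \<le> 4 * (real (card P) * n)"
    proof -
      have "ln H \<le> ln (4 * (real (card P) * n))" using that Hpos by (intro ln_mono) auto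
      then have "ln H \<le> 2 * ln 2 + ln (real (card P)) + ln n"
        using n_pos p_pos ln_realpow[of 2 2] by (simp add: ln_mult)
      then show False using lmain lptn ln_bounds by argo
    qed
    ultimately show ?thesis by blast
  qed
  have "ln (H ^ 3) \<le> ln (512 * (\<sigma> * n * (real (card P) * n))\<^sup>2)" using H3 Hpos by (intro ln_mono) auto
  then have "3 * ln H \<le> 9 * ln 2 + 2 * (ln \<sigma> + 2 * ln n + ln (real (card P)))"
    using sigma_pos n_pos p_pos ln_realpow[of 2 9] by (simp add: ln_mult ln_realpow)
  \<comment> \<open>\<open>L ^ 22\<close> covers L^3 from cubing \<open>main\<close>, L^16 from
    replacing n^8 by N^8, and the constant 2^15.\<close>
  then have "ln \<sigma> + 8 * ln N \<le> 22 * ln L + 3 * ln q + 3 * ln t + 2 * ln (real (card P))"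
    using lmain ln_bounds by argo
  then have "ln (\<sigma> * N ^ 8) \<le> ln (L ^ 22 * q ^ 3 * t ^ 3 * (real (card P))\<^sup>2)"
    using sigma_pos N_pos L_pos q_pos t1 p_pos by (simp add: ln_mult ln_realpow)
  then have "\<sigma> * N ^ 8 \<le> L ^ 22 * q ^ 3 * t ^ 3 * (real (card P))\<^sup>2"
    using sigma_pos N_pos L_pos q_pos t1 p_pos by (subst (asm) ln_le_cancel_iff) auto
  with that t1 finP P0 Pne tr(1) ptn show ?thesis by blast
qed

text \<open>Write y = b' - b. By \<open>deg\<close>, b' is a product of some u in \<open>A\<close>
  and l in \<open>S\<close> in at least N / L^2 ways. So each \<open>y\<close> yields sN / L^2
  incidences of lines with slope l and intercept -b with the grid
  \<open>A \<times> Y\<close>.\<close>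

lemma popular_differences_bound:
  assumes Y: "finite Y" "0 \<notin> Y" and s: "1 \<le> s" "\<And>y. y \<in> Y \<Longrightarrow> s \<le> r y"
  shows "real (card Y) * s ^ 3 \<le> L ^ 8 * \<sigma>\<^sup>2 * N"
proof (cases "Y = {}")
  case True
  then show ?thesis using L_pos by simp
next
  case False
  define m where "m = real (card Y)"
  have m_pos: "0 < m" using False Y by (simp add: m_def card_gt_0_iff)
  define J where "J = (\<Sum>u\<in>A. \<Sum>l\<in>S. real (card {c \<in> uminus ` B. c + u * l \<in> Y}))"
  define Z where "Z = (SIGMA y:Y. SIGMA b:reps B y. {c \<in> A. (b + y) / c \<in> S})"
  have "m * s * N = (\<Sum>y\<in>Y. s * N)" by (simp add: m_def)
  also have "\<dots> \<le> (\<Sum>y\<in>Y. \<Sum>b\<in>reps B y. N)"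
    using s by (intro sum_mono) (simp add: mult_right_mono)
  also have "\<dots> \<le> (\<Sum>y\<in>Y. \<Sum>b\<in>reps B y. L\<^sup>2 * real (card {c \<in> A. (b + y) / c \<in> S}))"
    by (intro sum_mono deg) (simp add: reps_def)
  also have "\<dots> = L\<^sup>2 * real (card Z)"
    unfolding Z_def using Y finB finA by (simp add: sum_distrib_left)
  also have "card Z \<le> card (SIGMA u:A. SIGMA l:S. {c \<in> uminus ` B. c + u * l \<in> Y})"
    by (rule card_inj_on_le[of "\<lambda>(y, b, c). (c, (b + y) / c, - b)"])
      (use A0 finA finS finB in \<open>auto simp: inj_on_def Z_def reps_def\<close>)
  also have "real (card (SIGMA u:A. SIGMA l:S. {c \<in> uminus ` B. c + u * l \<in> Y})) = J"
    unfolding J_def using finA finS finB by simp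
  finally have lower: "m * s * N \<le> L\<^sup>2 * J" using L_pos by simp
  have "0 < m * s * N" using m_pos s N_pos by simp
  then have "0 < L\<^sup>2 * J" using lower by linarith
  then have Jpos: "0 < J" using L_pos by (simp add: zero_less_mult_iff)
  have "ln (m * s * N) \<le> ln (L\<^sup>2 * J)" using lower \<open>0 < m * s * N\<close> by (intro ln_mono) auto
  then have llower: "ln m + ln s + ln N \<le> 2 * ln L + ln J"
    using m_pos s N_pos L_pos Jpos by (simp add: ln_mult ln_realpow)
  \<comment> \<open>With s \<le> N and \<open>N_le_sigma\<close>, the linear alternative of the
    incidence bound also gives the claim.\<close>
  obtain y where "y \<in> Y" using False by blast
  then have "s \<le> N" using s(2) r_le_N by (meson order_trans)
  then have ls: "ln s \<le> ln N" using s by (intro ln_mono) auto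
  have "card (uminus ` B) = card B" by (rule card_image) (simp add: inj_on_def)
  then have "J \<le> 4 * (\<sigma> * n) \<or> J ^ 3 \<le> 512 * (N * m * (\<sigma> * n))\<^sup>2"
    using product_incidences[OF finA Y(1) finS finite_imageI[OF finB, of uminus] S0]
    unfolding J_def m_def by simp
  then have "ln J \<le> 2 * ln 2 + ln \<sigma> + ln n \<or> 3 * ln J \<le> 9 * ln 2 + 2 * (ln N + ln m + ln \<sigma> + ln n)"
  proof
    assume "J \<le> 4 * (\<sigma> * n)"
    then have "ln J \<le> ln (4 * (\<sigma> * n))" using Jpos by (intro ln_mono) auto
    then show ?thesis using sigma_pos n_pos ln_realpow[of 2 2] by (simp add: ln_mult)
  next
    assume "J ^ 3 \<le> 512 * (N * m * (\<sigma> * n))\<^sup>2"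
    then have "ln (J ^ 3) \<le> ln (512 * (N * m * (\<sigma> * n))\<^sup>2)" using Jpos by (intro ln_mono) auto
    then show ?thesis
      using sigma_pos n_pos N_pos m_pos ln_realpow[of 2 9] by (simp add: ln_mult ln_realpow)
  qed
  then have "ln m + 3 * ln s \<le> 8 * ln L + 2 * ln \<sigma> + ln N"
    using llower ls ln_bounds by argo
  then have "ln (m * s ^ 3) \<le> ln (L ^ 8 * \<sigma>\<^sup>2 * N)"
    using m_pos s N_pos L_pos sigma_pos by (simp add: ln_mult ln_realpow)
  then show ?thesis
    using m_pos s N_pos L_pos sigma_pos unfolding m_def by (subst (asm) ln_le_cancel_iff) auto
qed

text \<open>Up to powers of \<open>L\<close>: on a level of m differences with \<open>r\<close>
  about t, the cubic incidence bound gives H \<le> (\<sigma> m N^2)^(2/3), and m t^3 \<le>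
  \<sigma>^2 N turns this into t^2 H \<le> \<sigma>^2 N^2.\<close>

lemma cubic_energy_bound:
  "(\<Sum>s\<in>S. \<Sum>y\<in>difference_set B. (r y)\<^sup>2 * r (s * y)) \<le> L ^ 11 * \<sigma>\<^sup>2 * N\<^sup>2"
proof -
  define X where "X = difference_set B - {0}"
  define w where "w y = (r y)\<^sup>2 * (\<Sum>s\<in>S. r (s * y))" for y
  have finX: "finite X" using finB by (simp add: X_def)
  have w0: "0 \<le> w x" for x unfolding w_def by (intro mult_nonneg_nonneg sum_nonneg) auto
  have levels: "1 \<le> card (reps B x) \<and> card (reps B x) < 2 ^ k" if "x \<in> X" for x
    using that card_reps_pos[OF finB] r_lt by (auto simp: X_def)
  obtain j where j: "sum w X \<le> real k * sum w {x \<in> X. 2 ^ j \<le> card (reps B x) \<and> card (reps B x) < 2 ^ (j + 1)}"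
    using dyadic_level[OF finX, of w "\<lambda>x. card (reps B x)" k] w0 levels by blast
  define Y where "Y = {x \<in> X. 2 ^ j \<le> card (reps B x) \<and> card (reps B x) < 2 ^ (j + 1)}"
  define t where "t = (2::real) ^ j"
  define m where "m = real (card Y)"
  have t1: "1 \<le> t" by (simp add: t_def)
  have finY: "finite Y" and Y0: "0 \<notin> Y" using finX by (auto simp: Y_def X_def)
  have tr: "t \<le> r x" "r x \<le> 2 * t" if "x \<in> Y" for x
  proof -
    have "2 ^ j \<le> card (reps B x)" "card (reps B x) \<le> 2 ^ (j + 1)" using that by (auto simp: Y_def)
    then have "real (2 ^ j) \<le> r x" "r x \<le> real (2 ^ (j + 1))" by (simp_all only: of_nat_le_iff)
    then show "t \<le> r x" "r x \<le> 2 * t" by (simp_all add: t_def)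
  qed
  define H where "H = (\<Sum>s\<in>S. \<Sum>y\<in>Y. r (s * y))"
  have H0: "0 \<le> H" by (auto simp: H_def intro!: sum_nonneg)
  have "sum w Y \<le> (\<Sum>x\<in>Y. (2 * t)\<^sup>2 * (\<Sum>s\<in>S. r (s * x)))"
    unfolding w_def using tr by (intro sum_mono mult_right_mono sum_nonneg power_mono) auto
  also have "\<dots> = (2 * t)\<^sup>2 * H" unfolding H_def by (subst sum.swap) (simp add: sum_distrib_left)
  finally have wY: "sum w Y \<le> 4 * (t\<^sup>2 * H)" by (simp add: power_mult_distrib)
  have tH0: "0 \<le> t\<^sup>2 * H" using H0 by simp
  have "sum w X \<le> real k * sum w Y" using j by (simp add: Y_def)
  also have "\<dots> \<le> real k * (4 * (t\<^sup>2 * H))" using wY by (intro mult_left_mono) auto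
  also have "\<dots> \<le> L * (4 * (t\<^sup>2 * H))" using tH0 L by (intro mult_right_mono) auto
  finally have wX: "sum w X \<le> 4 * L * (t\<^sup>2 * H)" by simp
  have tH: "t\<^sup>2 * H \<le> L ^ 9 * \<sigma>\<^sup>2 * N\<^sup>2"
  proof (cases "H = 0")
    case True
    then show ?thesis using L_pos by simp
  next
    case False
    then have Hpos: "0 < H" using H0 by simp
    have "Y \<noteq> {}" using False by (auto simp: H_def)
    then have m_pos: "0 < m" using finY by (simp add: m_def card_gt_0_iff)
    have "m * t ^ 3 \<le> L ^ 8 * \<sigma>\<^sup>2 * N"
      unfolding m_def by (rule popular_differences_bound[OF finY Y0 t1 tr(1)])
    then have "ln (m * t ^ 3) \<le> ln (L ^ 8 * \<sigma>\<^sup>2 * N)" using m_pos t1 by (intro ln_mono) auto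
    then have lm: "ln m + 3 * ln t \<le> 8 * ln L + 2 * ln \<sigma> + ln N"
      using m_pos t1 N_pos L_pos sigma_pos by (simp add: ln_mult ln_realpow)
    \<comment> \<open>For the linear alternative: t \<ge> 1 gives t^2 m n \<le> (m t^3) n.\<close>
    have lt: "0 \<le> ln t" using t1 by simp
    have "H \<le> 4 * (m * n) \<or> H ^ 3 \<le> 512 * (\<sigma> * n * (m * n))\<^sup>2"
      unfolding H_def m_def by (rule dilate_incidences[OF finY Y0])
    then have "ln H \<le> 2 * ln 2 + ln m + ln n \<or> 3 * ln H \<le> 9 * ln 2 + 2 * (ln \<sigma> + 2 * ln n + ln m)"
    proof
      assume "H \<le> 4 * (m * n)"
      then have "ln H \<le> ln (4 * (m * n))" using Hpos by (intro ln_mono) auto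
      then show ?thesis using m_pos n_pos ln_realpow[of 2 2] by (simp add: ln_mult)
    next
      assume "H ^ 3 \<le> 512 * (\<sigma> * n * (m * n))\<^sup>2"
      then have "ln (H ^ 3) \<le> ln (512 * (\<sigma> * n * (m * n))\<^sup>2)" using Hpos by (intro ln_mono) auto
      then show ?thesis
        using sigma_pos n_pos m_pos ln_realpow[of 2 9] by (simp add: ln_mult ln_realpow)
    qed
    then have "2 * ln t + ln H \<le> 9 * ln L + 2 * ln \<sigma> + 2 * ln N"
      using lm lt ln_bounds by argo
    then have "ln (t\<^sup>2 * H) \<le> ln (L ^ 9 * \<sigma>\<^sup>2 * N\<^sup>2)"
      using t1 Hpos N_pos L_pos sigma_pos by (simp add: ln_mult ln_realpow)
    then show ?thesis
      using t1 Hpos N_pos L_pos sigma_pos by (subst (asm) ln_le_cancel_iff) auto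
  qed
  have "0 \<in> difference_set B" using n_pos unfolding difference_set_def by (force simp: card_gt_0_iff)
  then have "(\<Sum>y\<in>difference_set B. w y) = w 0 + sum w X"
    unfolding X_def by (subst sum.remove[of _ 0]) (use finB in auto)
  moreover have "w 0 \<le> L\<^sup>2 * \<sigma>\<^sup>2 * N\<^sup>2"
  proof -
    have "w 0 = n\<^sup>2 * n * \<sigma>" by (simp add: w_def)
    also have "\<dots> \<le> N\<^sup>2 * N * \<sigma>" using n_le_N by (intro mult_mono power_mono) auto
    also have "\<dots> \<le> N\<^sup>2 * (L\<^sup>2 * \<sigma>) * \<sigma>"
    proof -
      have "N \<le> 2 * L * \<sigma>" by (rule N_le_sigma)
      also have "\<dots> \<le> L\<^sup>2 * \<sigma>" using L by (simp add: power2_eq_square mult_right_mono)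
      finally show ?thesis by (intro mult_mono) auto
    qed
    finally show ?thesis by (simp add: power2_eq_square mult_ac)
  qed
  moreover have "(\<Sum>s\<in>S. \<Sum>y\<in>difference_set B. (r y)\<^sup>2 * r (s * y)) = (\<Sum>y\<in>difference_set B. w y)"
    unfolding w_def by (subst sum.swap) (simp add: sum_distrib_left)
  moreover have "L\<^sup>2 * \<sigma>\<^sup>2 * N\<^sup>2 + 4 * L * (L ^ 9 * \<sigma>\<^sup>2 * N\<^sup>2) \<le> L ^ 11 * \<sigma>\<^sup>2 * N\<^sup>2"
  proof -
    have "L\<^sup>2 \<le> L ^ 10" using L by (intro power_increasing) auto
    moreover have "5 * L ^ 10 \<le> L * L ^ 10" using L by (intro mult_right_mono) auto
    ultimately have "L\<^sup>2 + 4 * L * L ^ 9 \<le> L ^ 11"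
      by (simp add: power_numeral_reduce)
    then have "(L\<^sup>2 + 4 * L * L ^ 9) * (\<sigma>\<^sup>2 * N\<^sup>2) \<le> L ^ 11 * (\<sigma>\<^sup>2 * N\<^sup>2)"
      by (intro mult_right_mono) auto
    then show ?thesis by (simp add: algebra_simps)
  qed
  moreover have "4 * L * (t\<^sup>2 * H) \<le> 4 * L * (L ^ 9 * \<sigma>\<^sup>2 * N\<^sup>2)"
    using tH L_pos by (intro mult_left_mono) auto
  ultimately show ?thesis using wX by linarith
qed

section \<open>Lower bounds for the sums of \<open>B\<close> with dilates of
  \<open>reps B x\<close>\<close>

text \<open>Katz--Koester: \<open>aB + (sa)B\<^sub>x\<close> lies in both \<open>Q\<close> and \<open>Q - (sa)x\<close>, where \<open>B\<^sub>x = reps B x\<close>.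
  So lower bounds for most of the sums \<open>B + sB\<^sub>x\<close> produce many incidences of the lines
  \<open>v = xu + v'\<close> with the grid \<open>A \<times> Q\<close>.\<close>

lemma dilate_sums_transfer:
  assumes P: "finite P" "0 \<notin> P" "P \<noteq> {}" and M: "0 < M"
    and Bad: "Bad \<subseteq> P \<times> S" "2 * real (card Bad) \<le> real (card P) * \<sigma>"
    and good: "\<And>x s. x \<in> P \<Longrightarrow> s \<in> S \<Longrightarrow> (x, s) \<notin> Bad \<Longrightarrow> M \<le> real (card (dilate_sum B s (reps B x)))"
  shows "ln N + ln M \<le> 2 * ln L + ln q \<or> ln (real (card P)) + ln N + 3 * ln M \<le> 5 * ln L + 4 * ln q"
proof -
  define p where "p = real (card P)"
  have p_pos: "0 < p" using P by (simp add: p_def card_gt_0_iff)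
  \<comment> \<open>Pairs with b = sa for some \<open>s\<close> that is not bad for x: the
    Katz-Koester inclusion then puts at least \<open>M\<close> elements into
    \<open>Q \<inter> (Q - bx)\<close>.\<close>
  define Gd where "Gd = {(b, x). b \<in> A \<and> x \<in> P \<and> (\<exists>s\<in>S. (x, s) \<notin> Bad \<and> b / s \<in> A)}"
  \<comment> \<open>Each of the at least p \<sigma> / 2 pairs (x, s) outside \<open>Bad\<close> has
    at least \<open>\<tau>\<close> choices of a, and a, sa, x determine the triple. With
    \<open>pop\<close>, \<open>Gd\<close> therefore has at least pN / (4L) elements.\<close>
  define Z where "Z = (SIGMA z:P \<times> S - Bad. {a \<in> A. snd z * a \<in> A})"
  define W where "W = (\<Sum>u\<in>A. \<Sum>x\<in>P. real (card {v \<in> Q. v + u * x \<in> Q}))"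
  have finGd: "finite Gd"
    by (rule finite_subset[of _ "A \<times> P"]) (use finA P in \<open>auto simp: Gd_def\<close>)
  have finBad: "finite Bad" using Bad P finS by (meson finite_SigmaI finite_subset)
  have "p * \<sigma> / 2 \<le> real (card (P \<times> S - Bad))"
    using Bad finBad by (simp add: card_Diff_subset card_cartesian_product p_def of_nat_diff
        card_mono[OF _ Bad(1), simplified card_cartesian_product] P finS)
  then have "\<tau> * (p * \<sigma> / 2) \<le> \<tau> * real (card (P \<times> S - Bad))"
    using tau_pos by (intro mult_left_mono) auto
  also have "\<dots> = (\<Sum>z\<in>P \<times> S - Bad. \<tau>)" by simp
  also have "\<dots> \<le> (\<Sum>z\<in>P \<times> S - Bad. real (card {a \<in> A. snd z * a \<in> A}))"
    by (intro sum_mono rep) auto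
  also have "\<dots> = real (card Z)" unfolding Z_def using P finS finA by simp
  also have "card Z \<le> card (A \<times> Gd)"
  proof (rule card_inj_on_le[of "\<lambda>(z, a). (a, snd z * a, fst z)"])
    show "inj_on (\<lambda>(z, a). (a, snd z * a, fst z)) Z"
      using A0 by (auto simp: inj_on_def Z_def)
    show "(\<lambda>(z, a). (a, snd z * a, fst z)) ` Z \<subseteq> A \<times> Gd"
      using S0 by (force simp: Z_def Gd_def)
    show "finite (A \<times> Gd)" using finA finGd by simp
  qed
  finally have Z: "\<tau> * (p * \<sigma> / 2) \<le> N * real (card Gd)" by (simp add: card_cartesian_product)
  have "p * N\<^sup>2 \<le> p * (2 * L * \<tau> * \<sigma>)" using pop p_pos by (intro mult_left_mono) auto
  also have "\<dots> = 4 * L * (\<tau> * (p * \<sigma> / 2))" by simp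
  also have "\<dots> \<le> 4 * L * (N * real (card Gd))" using Z L_pos by (intro mult_left_mono) auto
  finally have "N * (p * N) \<le> N * (4 * L * real (card Gd))" by (simp add: power2_eq_square mult_ac)
  then have Gd: "p * N \<le> 4 * L * real (card Gd)" using N_pos by simp
  have "real (card Gd) * M = (\<Sum>z\<in>Gd. M)" by simp
  also have "\<dots> \<le> (\<Sum>z\<in>Gd. real (card {v \<in> Q. v + fst z * snd z \<in> Q}))"
  proof (rule sum_mono)
    fix z assume "z \<in> Gd"
    then obtain b x s where z: "z = (b, x)" "b \<in> A" "x \<in> P" "s \<in> S" "(x, s) \<notin> Bad" "b / s \<in> A"
      by (auto simp: Gd_def)
    have sb: "s * (b / s) = b" using z S0 by auto
    have "M \<le> real (card (dilate_sum B s (reps B x)))" using good z by blast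
    also have "\<dots> \<le> real (card {v \<in> Q. v + b * x \<in> Q})"
      using dilate_sum_shift[OF z(4,6), of x] z(2) sb by simp
    finally show "M \<le> real (card {v \<in> Q. v + fst z * snd z \<in> Q})" using z by simp
  qed
  also have "\<dots> \<le> (\<Sum>z\<in>A \<times> P. real (card {v \<in> Q. v + fst z * snd z \<in> Q}))"
    by (rule sum_mono2) (use finA P in \<open>auto simp: Gd_def\<close>)
  also have "\<dots> = W" unfolding W_def by (simp add: sum.cartesian_product case_prod_beta)
  finally have GW: "real (card Gd) * M \<le> W" .
  have "p * N * M \<le> 4 * L * real (card Gd) * M" using Gd M by (intro mult_right_mono) auto
  also have "\<dots> \<le> 4 * L * W" using GW L_pos by (simp add: mult.assoc)
  finally have lower: "p * N * M \<le> 4 * L * W" .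
  have pos: "0 < p * N * M" using p_pos N_pos M by simp
  then have "0 < 4 * L * W" using lower by linarith
  then have Wpos: "0 < W" using L_pos by (simp add: zero_less_mult_iff)
  have "ln (p * N * M) \<le> ln (4 * L * W)" using lower pos by (intro ln_mono) auto
  then have ll: "ln p + ln N + ln M \<le> 2 * ln 2 + ln L + ln W"
    using p_pos N_pos M L_pos Wpos ln_realpow[of 2 2] by (simp add: ln_mult)
  have "W \<le> 4 * (p * q) \<or> W ^ 3 \<le> 512 * (N * q * (p * q))\<^sup>2"
    unfolding W_def p_def by (rule product_incidences[OF finA finQ P(1) finQ P(2)])
  then have "ln W \<le> 2 * ln 2 + ln p + ln q \<or> 3 * ln W \<le> 9 * ln 2 + 2 * (ln N + 2 * ln q + ln p)"
  proof
    assume "W \<le> 4 * (p * q)"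
    then have "ln W \<le> ln (4 * (p * q))" using Wpos by (intro ln_mono) auto
    then show ?thesis using p_pos q_pos ln_realpow[of 2 2] by (simp add: ln_mult)
  next
    assume "W ^ 3 \<le> 512 * (N * q * (p * q))\<^sup>2"
    then have "ln (W ^ 3) \<le> ln (512 * (N * q * (p * q))\<^sup>2)" using Wpos by (intro ln_mono) auto
    then show ?thesis
      using N_pos p_pos q_pos ln_realpow[of 2 9] by (simp add: ln_mult ln_realpow)
  qed
  \<comment> \<open>The linear alternative gives N M \<le> 16 L q, the cubic one p N M^3 \<le> 2^15
    L^3 q^4.\<close>
  then show ?thesis using ll ln_bounds unfolding p_def[symmetric] by argo
qed

text \<open>For each \<open>s\<close> in \<open>T\<close>, fewer than \<open>M\<close> lines of
  slope -s cover the grid \<open>C \<times> B\<close>, so at most |T| M lines have |T| |C| n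
  incidences. The incidence bound limits |T|; the assumption on \<open>4 * M\<close> excludes its
  linear alternative.\<close>

lemma few_small_dilate_sums:
  assumes C: "C \<subseteq> B" "C \<noteq> {}" and M: "4 * M < real (card C) * n" "0 < M"
  defines "T \<equiv> {s \<in> S. real (card (dilate_sum B s C)) < M}"
  shows "real (card T) * (real (card C) * n) \<le> 512 * M\<^sup>2"
proof -
  define c where "c = real (card C)"
  define \<beta> where "\<beta> = real (card T)"
  have fin: "finite C" "finite T" using C finB finS by (auto simp: T_def intro: finite_subset)
  have c_pos: "0 < c" using C fin by (simp add: c_def card_gt_0_iff)
  define Ls where "Ls = (\<lambda>(s, v). (- s, v)) ` (SIGMA s:T. dilate_sum B s C)"
  define I where "I = card {((l, v), u). (l, v) \<in> Ls \<and> u \<in> C \<and> l * u + v \<in> B}"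
  have finLs: "finite Ls" using fin finB by (simp add: Ls_def)
  have "card Ls \<le> card (SIGMA s:T. dilate_sum B s C)" unfolding Ls_def
    using fin finB by (intro card_image_le) auto
  then have "real (card Ls) \<le> (\<Sum>s\<in>T. real (card (dilate_sum B s C)))"
    using fin finB by (simp flip: of_nat_sum)
  also have "\<dots> \<le> (\<Sum>s\<in>T. M)" by (intro sum_mono) (auto simp: T_def)
  finally have cLs: "real (card Ls) \<le> \<beta> * M" by (simp add: \<beta>_def)
  have "card (T \<times> (B \<times> C)) \<le> I" unfolding I_def
  proof (rule card_inj_on_le[of "\<lambda>(s, (b, u)). ((- s, b + s * u), u)"])
    show "inj_on (\<lambda>(s, (b, u)). ((- s, b + s * u), u)) (T \<times> (B \<times> C))"
      by (auto simp: inj_on_def)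
    show "(\<lambda>(s, (b, u)). ((- s, b + s * u), u)) ` (T \<times> (B \<times> C))
        \<subseteq> {((l, v), u). (l, v) \<in> Ls \<and> u \<in> C \<and> l * u + v \<in> B}"
      by (auto simp: Ls_def dilate_sum_def image_iff)
    show "finite {((l, v), u). (l, v) \<in> Ls \<and> u \<in> C \<and> l * u + v \<in> B}"
      by (rule finite_subset[of _ "Ls \<times> C"]) (use finLs fin in auto)
  qed
  then have "real (card (T \<times> (B \<times> C))) \<le> real I" by (rule of_nat_mono)
  then have I: "\<beta> * (c * n) \<le> real I"
    by (simp add: card_cartesian_product \<beta>_def c_def mult_ac)
  have "I \<le> 4 * card Ls \<or> I ^ 3 \<le> 512 * (card C * card B * card Ls)\<^sup>2"
    unfolding I_def using S0 by (intro grid_incidences fin finB finLs) (auto simp: Ls_def T_def)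
  then have "\<beta> * (c * n) \<le> 512 * M\<^sup>2"
  proof
    assume "I \<le> 4 * card Ls"
    then have "\<beta> * (c * n) \<le> 4 * (\<beta> * M)" using I cLs by linarith
    then have "\<beta> * (c * n - 4 * M) \<le> 0" by (simp add: algebra_simps)
    then have "\<beta> \<le> 0" using M(1) unfolding c_def[symmetric] by (simp add: mult_le_0_iff)
    then have "\<beta> = 0" by (simp add: \<beta>_def)
    then show ?thesis by simp
  next
    assume "I ^ 3 \<le> 512 * (card C * card B * card Ls)\<^sup>2"
    then have "real (I ^ 3) \<le> real (512 * (card C * card B * card Ls)\<^sup>2)" by (rule of_nat_mono)
    then have I3: "real I ^ 3 \<le> 512 * (c * n * real (card Ls))\<^sup>2" by (simp add: c_def)
    show ?thesis
    proof (cases "\<beta> = 0")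
      case False
      then have b_pos: "0 < \<beta>" by (simp add: \<beta>_def)
      have "(\<beta> * (c * n)) ^ 3 \<le> real I ^ 3" using I b_pos c_pos n_pos by (intro power_mono) auto
      also note I3
      also have "512 * (c * n * real (card Ls))\<^sup>2 \<le> 512 * (c * n * (\<beta> * M))\<^sup>2"
        using cLs c_pos n_pos by (intro mult_left_mono power_mono) auto
      finally have "(\<beta> * (c * n))\<^sup>2 * (\<beta> * (c * n)) \<le> (\<beta> * (c * n))\<^sup>2 * (512 * M\<^sup>2)"
        by (simp add: power2_eq_square power3_eq_cube mult_ac)
      then show ?thesis using b_pos c_pos n_pos by simp
    qed simp
  qed
  then show ?thesis by (simp add: \<beta>_def c_def)
qed

section \<open>Combination of the two lower bounds\<close>

text \<open>\<open>dilate_sums_transfer\<close> is used with two values of \<open>M\<close>, each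
  making at most half of the pairs (x, s) bad. Its first alternative contradicts q^5 \<le> N^8 both
  times; its second, combined with \<open>key\<close>, gives \<open>first\<close> and
  \<open>second\<close>.\<close>

lemma card_products_sum_ln_bound: "81 * ln N \<le> 500 * ln L + 51 * ln q"
proof -
  obtain t P where t1: "1 \<le> t" and P: "finite P" "0 \<notin> P" "P \<noteq> {}" and tr: "\<And>x. x \<in> P \<Longrightarrow> t \<le> r x"
    and tp: "t * real (card P) \<le> N\<^sup>2"
    and key: "\<sigma> * N ^ 8 \<le> L ^ 22 * q ^ 3 * t ^ 3 * (real (card P))\<^sup>2"
    by (rule popular_differences) blast
  define p where "p = real (card P)"
  have p_pos: "0 < p" using P by (simp add: p_def card_gt_0_iff)
  have "ln (t * p) \<le> ln (N\<^sup>2)" using tp t1 p_pos by (intro ln_mono) (auto simp: p_def)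
  then have ltp: "ln t + ln p \<le> 2 * ln N" using t1 p_pos by (simp add: ln_mult ln_realpow)
  have "ln (\<sigma> * N ^ 8) \<le> ln (L ^ 22 * q ^ 3 * t ^ 3 * p\<^sup>2)"
    using key sigma_pos N_pos by (intro ln_mono) (auto simp: p_def)
  then have lkey: "ln \<sigma> + 8 * ln N \<le> 22 * ln L + 3 * ln q + 3 * ln t + 2 * ln p"
    using sigma_pos N_pos L_pos q_pos t1 p_pos by (simp add: ln_mult ln_realpow)

  have first: "4 * ln \<sigma> + 13 * ln N \<le> 100 * ln L + 11 * ln q"
  proof -
    \<comment> \<open>Chosen so that 512 M^2 = (\<sigma> / 2) t n: by
      \<open>few_small_dilate_sums\<close>, at most half of \<open>S\<close> is bad for each
      x.\<close>
    define M where "M = sqrt (t * n * \<sigma> / 1024)"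
    have M_pos: "0 < M" using t1 n_pos sigma_pos by (simp add: M_def)
    have M2: "M\<^sup>2 = t * n * \<sigma> / 1024" using t1 by (simp add: M_def)
    have "ln (M\<^sup>2 * 2 ^ 10) = ln (t * n * \<sigma>)" using M2 by simp
    then have lM: "2 * ln M = ln t + ln n + ln \<sigma> - 10 * ln 2"
      using M_pos t1 n_pos sigma_pos ln_realpow[of 2 10] by (simp add: ln_mult ln_realpow)
    \<comment> \<open>This amounts to 4 M < t n. Up to powers of \<open>L\<close>,
      \<open>lkey\<close> and \<open>ltp\<close> give t \<ge> \<sigma> N^4 / q^3, and q^3 \<le>
      N^(24/5).\<close>
    have "ln \<sigma> < 6 * ln 2 + ln t + ln n" using lkey ltp ln_bounds by argo
    then have lt: "4 * ln 2 + 2 * ln M < 2 * (ln t + ln n)" using lM by argo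
    have "2 * ln 2 + ln M < ln t + ln n" using lt by argo
    then have "ln (4 * M) < ln (t * n)"
      using M_pos t1 n_pos ln_realpow[of 2 2] by (simp add: ln_mult)
    then have M4: "4 * M < t * n" using M_pos t1 n_pos by simp
    define Bad where "Bad = (SIGMA x:P. {s \<in> S. real (card (dilate_sum B s (reps B x))) < M})"
    have each: "2 * real (card {s \<in> S. real (card (dilate_sum B s (reps B x))) < M}) \<le> \<sigma>"
      if "x \<in> P" for x
    proof -
      define T where "T = {s \<in> S. real (card (dilate_sum B s (reps B x))) < M}"
      have "t * n \<le> r x * n" using tr[OF that] by (intro mult_right_mono) auto
      then have "4 * M < r x * n" using M4 by linarith
      moreover have "reps B x \<noteq> {}" using tr[OF that] t1 by auto
      ultimately have "real (card T) * (r x * n) \<le> 512 * M\<^sup>2"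
        unfolding T_def using M_pos by (intro few_small_dilate_sums) (auto simp: reps_def)
      moreover have "real (card T) * (t * n) \<le> real (card T) * (r x * n)"
        using \<open>t * n \<le> r x * n\<close> by (intro mult_left_mono) auto
      ultimately have "real (card T) * (t * n) \<le> \<sigma> / 2 * (t * n)" using M2 by (simp add: mult_ac)
      then have "real (card T) \<le> \<sigma> / 2" using t1 n_pos by (simp del: times_divide_eq_left)
      then show ?thesis by (simp add: T_def)
    qed
    have "2 * real (card Bad) = (\<Sum>x\<in>P. 2 * real (card {s \<in> S. real (card (dilate_sum B s (reps B x))) < M}))"
      unfolding Bad_def using P finS by (simp add: sum_distrib_left)
    also have "\<dots> \<le> (\<Sum>x\<in>P. \<sigma>)" by (intro sum_mono each)
    finally have "2 * real (card Bad) \<le> real (card P) * \<sigma>" by simp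
    then have "ln N + ln M \<le> 2 * ln L + ln q \<or> ln p + ln N + 3 * ln M \<le> 5 * ln L + 4 * ln q"
      unfolding p_def using P M_pos
      by (intro dilate_sums_transfer[where Bad = Bad]) (auto simp: Bad_def not_less)
    then show ?thesis using lM lkey ltp ln_bounds by argo
  qed

  have second: "17 * ln N \<le> 100 * ln L + ln \<sigma> + 10 * ln q"
  proof -
    \<comment> \<open>\<open>L ^ 16\<close> combines L^11 from \<open>cubic_energy_bound\<close>,
      L^4 from N^2 \<le> L^4 n^2, and one more \<open>L\<close> that beats the 2 in
      \<open>2 * real (card Bad)\<close>.\<close>
    define M where "M = p * t\<^sup>2 / (L ^ 16 * \<sigma>)"
    have M_pos: "0 < M" using p_pos t1 sigma_pos L_pos by (simp add: M_def)
    have "ln (M * (L ^ 16 * \<sigma>)) = ln (p * t\<^sup>2)" using sigma_pos L_pos by (simp add: M_def)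
    then have lM: "ln M + 16 * ln L + ln \<sigma> = ln p + 2 * ln t"
      using M_pos p_pos t1 sigma_pos L_pos by (simp add: ln_mult ln_realpow)
    define Bad where "Bad = {(x, s). x \<in> P \<and> s \<in> S \<and> real (card (dilate_sum B s (reps B x))) < M}"
    \<comment> \<open>The energy of \<open>dilate_sum_energy\<close> for \<open>reps B x\<close>.
      Bad pairs have small sums and hence large energy, while summation over x in \<open>P\<close>
      leaves only the third moment.\<close>
    define E where "E x s = (\<Sum>y\<in>difference_set B. real (card (reps (reps B x) y)) * r (s * y))" for x s
    have E0: "0 \<le> E x s" for x s by (auto simp: E_def intro!: sum_nonneg)
    have finBad: "finite Bad" and BadPS: "Bad \<subseteq> P \<times> S"
      using P finS by (auto simp: Bad_def intro: finite_subset[of _ "P \<times> S"])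
    have "real (card Bad) * (n * t)\<^sup>2 = (\<Sum>z\<in>Bad. (n * t)\<^sup>2)" by simp
    also have "\<dots> \<le> (\<Sum>z\<in>Bad. M * E (fst z) (snd z))"
    proof (rule sum_mono)
      fix z assume "z \<in> Bad"
      then obtain x s where z: "z = (x, s)" "x \<in> P" "s \<in> S" "real (card (dilate_sum B s (reps B x))) < M"
        by (auto simp: Bad_def)
      have "(n * t)\<^sup>2 \<le> (n * r x)\<^sup>2" using tr[OF z(2)] t1 by (intro power_mono mult_left_mono) auto
      also have "\<dots> \<le> real (card (dilate_sum B s (reps B x))) * E x s"
        unfolding E_def by (rule dilate_sum_energy[OF finB]) (auto simp: reps_def)
      also have "\<dots> \<le> M * E x s" using z E0 by (intro mult_right_mono) auto
      finally show "(n * t)\<^sup>2 \<le> M * E (fst z) (snd z)" by (simp add: z)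
    qed
    also have "\<dots> \<le> (\<Sum>z\<in>P \<times> S. M * E (fst z) (snd z))"
      using P finS BadPS E0 M_pos by (intro sum_mono2) auto
    also have "\<dots> = M * (\<Sum>s\<in>S. \<Sum>x\<in>P. E x s)"
      by (subst sum.swap) (simp add: sum.cartesian_product sum_distrib_left case_prod_beta)
    also have "\<dots> \<le> M * (\<Sum>s\<in>S. \<Sum>y\<in>difference_set B. (r y)\<^sup>2 * r (s * y))"
    proof (intro mult_left_mono sum_mono)
      fix s
      have "(\<Sum>x\<in>P. E x s) = (\<Sum>y\<in>difference_set B. real (\<Sum>x\<in>P. card (reps (reps B x) y)) * r (s * y))"
        unfolding E_def by (subst sum.swap) (simp add: sum_distrib_right)
      also have "\<dots> \<le> (\<Sum>y\<in>difference_set B. real ((card (reps B y))\<^sup>2) * r (s * y))"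
        by (intro sum_mono mult_right_mono of_nat_mono sum_card_reps_reps_le finB P) auto
      finally show "(\<Sum>x\<in>P. E x s) \<le> (\<Sum>y\<in>difference_set B. (r y)\<^sup>2 * r (s * y))" by simp
    qed (use M_pos in auto)
    also have "\<dots> \<le> M * (L ^ 11 * \<sigma>\<^sup>2 * N\<^sup>2)"
      using cubic_energy_bound M_pos by (intro mult_left_mono) auto
    finally have bad: "real (card Bad) * (n * t)\<^sup>2 \<le> M * (L ^ 11 * \<sigma>\<^sup>2 * N\<^sup>2)" .
    have "2 * real (card Bad) \<le> p * \<sigma>"
    proof (cases "card Bad = 0")
      case False
      then have c_pos: "0 < real (card Bad)" by simp
      have "ln (real (card Bad) * (n * t)\<^sup>2) \<le> ln (M * (L ^ 11 * \<sigma>\<^sup>2 * N\<^sup>2))"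
        using bad c_pos n_pos t1 by (intro ln_mono) auto
      then have "ln (real (card Bad)) + 2 * (ln n + ln t) \<le> ln M + 11 * ln L + 2 * ln \<sigma> + 2 * ln N"
        using c_pos n_pos t1 M_pos L_pos sigma_pos N_pos by (simp add: ln_mult ln_realpow)
      then have "ln 2 + ln (real (card Bad)) \<le> ln p + ln \<sigma>" using lM ln_bounds by argo
      then have "ln (2 * real (card Bad)) \<le> ln (p * \<sigma>)"
        using c_pos p_pos sigma_pos by (simp add: ln_mult)
      then show ?thesis using c_pos p_pos sigma_pos by (subst (asm) ln_le_cancel_iff) auto
    qed (use p_pos in simp)
    then have "ln N + ln M \<le> 2 * ln L + ln q \<or> ln p + ln N + 3 * ln M \<le> 5 * ln L + 4 * ln q"
      unfolding p_def using P M_pos BadPS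
      by (intro dilate_sums_transfer[where Bad = Bad]) (auto simp: Bad_def not_less)
    then show ?thesis using lM lkey ltp ln_bounds by argo
  qed

  \<comment> \<open>\<open>first\<close> plus four times \<open>second\<close> cancels
    \<open>ln \<sigma>\<close>.\<close>
  show ?thesis using first second ln_bounds by argo
qed

end

section \<open>The theorem\<close>

text \<open>\<open>S\<close> is a dyadic level of ratios that carries at least N^2 / L pairs, and
  \<open>B\<close> consists of the numerators occurring in many of them. One numerator occurs in at
  most N pairs, so \<open>B\<close> must be large.\<close>

lemma ratio_structure_exists:
  fixes A :: "real set"
  assumes finA: "finite A" and A0: "0 \<notin> A" and L: "2048 \<le> L" "real k \<le> L" and k: "card A < 2 ^ k"
    and large: "L ^ 1000 \<le> real (card A)"
    and small: "real (card (A * A + A * A)) ^ 5 \<le> real (card A) ^ 8"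
  obtains B S \<tau> where "ratio_structure A B S L \<tau> k"
proof -
  define N where "N = real (card A)"
  have Lp: "0 < L" using L by simp
  have Np: "0 < N" using large Lp unfolding N_def by (metis zero_less_power less_le_trans)
  define X where "X = (\<lambda>(a, b). b / a) ` (A \<times> A)"
  define f where "f s = card {a \<in> A. s * a \<in> A}" for s
  have finX: "finite X" using finA by (simp add: X_def)
  have levels: "1 \<le> f s \<and> f s < 2 ^ k" if "s \<in> X" for s
  proof -
    obtain a b where "a \<in> A" "b \<in> A" "s = b / a" using \<open>s \<in> X\<close> by (auto simp: X_def)
    then have "a \<in> {a \<in> A. s * a \<in> A}" using A0 by auto
    then have "1 \<le> f s" using finA by (auto simp: f_def Suc_le_eq card_gt_0_iff)
    moreover have "f s \<le> card A" unfolding f_def using finA by (intro card_mono) auto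
    ultimately show ?thesis using k by simp
  qed
  have "card (A \<times> A) \<le> card (SIGMA s:X. {a \<in> A. s * a \<in> A})"
    by (rule card_inj_on_le[of "\<lambda>(a, b). (b / a, a)"])
      (use A0 finA finX in \<open>auto simp: inj_on_def X_def\<close>)
  also have "\<dots> = (\<Sum>s\<in>X. f s)" using finX finA by (simp add: f_def)
  finally have "real (card (A \<times> A)) \<le> real (\<Sum>s\<in>X. f s)" by (rule of_nat_mono)
  then have total: "N\<^sup>2 \<le> (\<Sum>s\<in>X. real (f s))"
    by (simp add: N_def card_cartesian_product power2_eq_square)
  obtain j where j: "(\<Sum>s\<in>X. real (f s)) \<le> real k * (\<Sum>s | s \<in> X \<and> 2 ^ j \<le> f s \<and> f s < 2 ^ (j + 1). real (f s))"
    using dyadic_level[OF finX, of "\<lambda>s. real (f s)" f k] levels by auto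
  define S where "S = {s \<in> X. 2 ^ j \<le> f s \<and> f s < 2 ^ (j + 1)}"
  define \<tau> where "\<tau> = (2::real) ^ j"
  have finS: "finite S" using finX by (simp add: S_def)
  have S0: "0 \<notin> S" using A0 by (auto simp: S_def X_def)
  have tau: "\<tau> \<le> real (f s)" "real (f s) \<le> 2 * \<tau>" if "s \<in> S" for s
  proof -
    have "2 ^ j \<le> f s" "f s \<le> 2 ^ (j + 1)" using that by (auto simp: S_def)
    then have "real (2 ^ j) \<le> real (f s)" "real (f s) \<le> real (2 ^ (j + 1))"
      by (simp_all only: of_nat_le_iff)
    then show "\<tau> \<le> real (f s)" "real (f s) \<le> 2 * \<tau>" by (simp_all add: \<tau>_def)
  qed
  define g where "g = (\<Sum>s\<in>S. real (f s))"
  have "N\<^sup>2 \<le> real k * g" using total j by (simp add: g_def S_def)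
  also have "\<dots> \<le> L * g" using L by (intro mult_right_mono) (auto simp: g_def intro: sum_nonneg)
  finally have g: "N\<^sup>2 \<le> L * g" .
  have "g \<le> (\<Sum>s\<in>S. 2 * \<tau>)" unfolding g_def by (intro sum_mono tau)
  then have "L * g \<le> L * (real (card S) * (2 * \<tau>))" using Lp by simp
  then have pop: "N\<^sup>2 \<le> 2 * L * \<tau> * real (card S)" using g by (simp add: mult_ac)
  define d where "d b = real (card {c \<in> A. b / c \<in> S})" for b
  define B where "B = {b \<in> A. N \<le> L\<^sup>2 * d b}"
  have "B \<subseteq> A" by (auto simp: B_def)
  have dN: "d b \<le> N" for b
    unfolding d_def N_def using finA by (simp add: card_mono)
  have "card (SIGMA s:S. {a \<in> A. s * a \<in> A}) \<le> card (SIGMA b:A. {c \<in> A. b / c \<in> S})"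
    by (rule card_inj_on_le[of "\<lambda>(s, a). (s * a, a)"])
      (use A0 finA finS in \<open>auto simp: inj_on_def\<close>)
  then have "real (\<Sum>s\<in>S. f s) \<le> real (\<Sum>b\<in>A. card {c \<in> A. b / c \<in> S})"
    using finS finA by (intro of_nat_mono) (simp add: f_def)
  then have "g \<le> (\<Sum>b\<in>A. d b)" by (simp add: g_def d_def)
  also have "\<dots> = (\<Sum>b\<in>B. d b) + (\<Sum>b\<in>A - B. d b)"
    using sum.subset_diff[OF \<open>B \<subseteq> A\<close> finA, of d] by (simp add: add.commute)
  \<comment> \<open>Numerators outside \<open>B\<close> contribute at most N^2 / L^2 in total, at
    most half of the N^2 / L pairs carried by \<open>S\<close>.\<close>
  also have "\<dots> \<le> (\<Sum>b\<in>B. N) + (\<Sum>b\<in>A - B. N / L\<^sup>2)"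
    using dN Lp by (intro add_mono sum_mono) (auto simp: B_def field_simps)
  also have "\<dots> \<le> real (card B) * N + N * (N / L\<^sup>2)"
  proof -
    have "card (A - B) \<le> card A" using finA by (intro card_mono) auto
    then have "real (card (A - B)) * (N / L\<^sup>2) \<le> N * (N / L\<^sup>2)"
      using Np by (intro mult_right_mono) (auto simp: N_def)
    then show ?thesis by simp
  qed
  finally have "L\<^sup>2 * g \<le> L\<^sup>2 * (real (card B) * N + N * (N / L\<^sup>2))"
    by (intro mult_left_mono) auto
  also have "\<dots> = L\<^sup>2 * real (card B) * N + N * N" using Lp by (simp add: algebra_simps)
  finally have up: "L\<^sup>2 * g \<le> L\<^sup>2 * real (card B) * N + N * N" .
  have "2 * (N * N) \<le> L * (N * N)" using L by (intro mult_right_mono) auto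
  also have "\<dots> \<le> L * (L * g)" using g Lp by (simp add: power2_eq_square)
  finally have "2 * (N * N) \<le> L\<^sup>2 * g" by (simp add: power2_eq_square)
  then have "N * N \<le> L\<^sup>2 * real (card B) * N" using up by linarith
  then have cardB: "N \<le> L\<^sup>2 * real (card B)" using Np by simp
  have "ratio_structure A B S L \<tau> k"
    using assms finS S0 tau(1) pop cardB
    by unfold_locales (auto simp: B_def N_def d_def f_def)
  then show ?thesis by (rule that)
qed

lemma card_sum_of_products_bound:
  fixes A :: "real set"
  assumes finA: "finite A" and A0: "0 \<notin> A" and L: "2049 + log 2 (real (card A)) \<le> L"
    and large: "L ^ 1000 \<le> real (card A)" "1 \<le> card A"
  shows "81 * ln (real (card A)) \<le> 500 * ln L + 51 * ln (real (card (A * A + A * A)))"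
proof -
  have lg: "0 \<le> log 2 (real (card A))" using large by simp
  then have L1: "2048 \<le> L" using L by linarith
  show ?thesis
  proof (cases "real (card (A * A + A * A)) ^ 5 \<le> real (card A) ^ 8")
    case True
    obtain j where j: "2 ^ j \<le> card A" "card A < 2 ^ (j + 1)"
      using ex_power_ivl1[of 2 "card A"] large by auto
    have "real (2 ^ j) \<le> real (card A)" using j(1) by (rule of_nat_mono)
    then have "real j \<le> log 2 (real (card A))"
      using large by (simp add: le_log_iff powr_realpow)
    then have "real (j + 1) \<le> L" using L by simp
    then obtain B S \<tau> where "ratio_structure A B S L \<tau> (j + 1)"
      using ratio_structure_exists[OF finA A0 L1 _ j(2) large(1) True] by blast
    then show ?thesis by (rule ratio_structure.card_products_sum_ln_bound)
  next
    \<comment> \<open>Here |AA + AA| exceeds |A|^(8/5), and 8/5 > 81/51.\<close>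
    case False
    then have "ln (real (card A) ^ 8) \<le> ln (real (card (A * A + A * A)) ^ 5)"
      using large by (intro ln_mono) auto
    then have "8 * ln (real (card A)) \<le> 5 * ln (real (card (A * A + A * A)))"
      by (simp add: ln_realpow)
    moreover have "0 \<le> ln L" "0 \<le> ln (real (card A))" using L1 large by auto
    ultimately show ?thesis by argo
  qed
qed

theorem theorem1p3:
  "\<exists>\<epsilon> :: nat \<Rightarrow> real. \<epsilon> \<longlonglongrightarrow> 0 \<and>
     (\<forall>A :: real set. finite A \<longrightarrow>
        real (card (A * A + A * A)) \<ge> real (card A) powr (3 / 2 + 7 / 80 - \<epsilon> (card A)))"
proof -
  \<comment> \<open>\<open>n - 1\<close> allows for removing 0 from \<open>A\<close>. The second
    estimate below holds because 51 * 127/80 < 81 leaves room for the logarithmic loss.\<close>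
  have "eventually (\<lambda>n. 1000 * ln (2049 + log 2 (real n)) \<le> ln (real n - 1)) sequentially"
    by real_asymp
  moreover have "eventually (\<lambda>n. 51 * (127 / 80) * ln (real n) \<le>
      81 * ln (real n - 1) - 500 * ln (2049 + log 2 (real n))) sequentially"
    by real_asymp
  ultimately have "eventually (\<lambda>n. 1000 * ln (2049 + log 2 (real n)) \<le> ln (real n - 1) \<and>
      51 * (127 / 80) * ln (real n) \<le> 81 * ln (real n - 1) - 500 * ln (2049 + log 2 (real n)) \<and> 2 \<le> n) sequentially"
    using eventually_ge_at_top[of 2] by eventually_elim auto
  then obtain n0 where n0: "\<And>n. n \<ge> n0 \<Longrightarrow> 1000 * ln (2049 + log 2 (real n)) \<le> ln (real n - 1) \<and>
      51 * (127 / 80) * ln (real n) \<le> 81 * ln (real n - 1) - 500 * ln (2049 + log 2 (real n)) \<and> 2 \<le> n"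
    by (auto simp: eventually_sequentially)
  \<comment> \<open>As 81/51 > 127/80, large sets leave no loss. For small sets the exponent becomes
    0, where \<open>powr\<close> gives 1, or 0 for the empty set.\<close>
  define \<epsilon> :: "nat \<Rightarrow> real" where "\<epsilon> n = (if n < n0 then 3 / 2 + 7 / 80 else 0)" for n
  have "eventually (\<lambda>n. \<epsilon> n = 0) sequentially"
    using eventually_ge_at_top[of n0] by eventually_elim (simp add: \<epsilon>_def)
  then have "\<epsilon> \<longlonglongrightarrow> 0" by (rule tendsto_eventually)
  moreover have "real (card (A * A + A * A)) \<ge> real (card A) powr (3 / 2 + 7 / 80 - \<epsilon> (card A))"
    if finA: "finite A" for A :: "real set"
  proof -
    have finQ: "finite (A * A + A * A)" using finA by (simp add: finite_set_times finite_set_plus)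
    have Qpos: "1 \<le> card (A * A + A * A)" if ne: "A \<noteq> {}"
    proof -
      obtain a where "a \<in> A" using ne by blast
      then have "a * a + a * a \<in> A * A + A * A" by (intro set_plus_intro set_times_intro)
      then show ?thesis using finQ by (auto simp: Suc_le_eq card_gt_0_iff)
    qed
    show ?thesis
    proof (cases "card A < n0")
      case True
      then show ?thesis using Qpos finA by (cases "A = {}") (auto simp: \<epsilon>_def)
    next
      case False
      define n where "n = card A"
      define C where "C = A - {0}"
      define L where "L = 2049 + log 2 (real n)"
      have n: "1000 * ln L \<le> ln (real n - 1)"
        "51 * (127 / 80) * ln (real n) \<le> 81 * ln (real n - 1) - 500 * ln L" "2 \<le> n"
        using n0[of n] False by (auto simp: n_def L_def)
      have C: "finite C" "0 \<notin> C" using finA by (auto simp: C_def)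
      have cC: "real n - 1 \<le> real (card C)" "card C \<le> n" "1 \<le> card C"
        using finA n(3) by (auto simp: C_def n_def card_Diff_singleton_if)
      have Lp: "0 < L" using n(3) by (simp add: L_def add_pos_nonneg)
      have lnC: "ln (real n - 1) \<le> ln (real (card C))" using cC n(3) by (intro ln_mono) auto
      have "ln (L ^ 1000) \<le> ln (real (card C))" using n(1) lnC by (simp add: ln_realpow)
      then have large: "L ^ 1000 \<le> real (card C)" using Lp cC(3) by (subst (asm) ln_le_cancel_iff) auto
      have "log 2 (real (card C)) \<le> log 2 (real n)" using cC by simp
      then have "81 * ln (real (card C)) \<le> 500 * ln L + 51 * ln (real (card (C * C + C * C)))"
        using card_sum_of_products_bound[OF C _ large cC(3)] by (simp add: L_def)
      moreover have "ln (real (card (C * C + C * C))) \<le> ln (real (card (A * A + A * A)))"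
      proof -
        have "C * C + C * C \<subseteq> A * A + A * A"
          by (intro set_plus_mono2 set_times_mono2) (auto simp: C_def)
        then have "card (C * C + C * C) \<le> card (A * A + A * A)" using finQ by (rule card_mono[rotated])
        moreover obtain c where "c \<in> C" using cC(3) by (metis card.empty equals0I not_one_le_zero)
        then have "c * c + c * c \<in> C * C + C * C" by (intro set_plus_intro set_times_intro)
        then have "0 < card (C * C + C * C)"
          using C by (auto simp: card_gt_0_iff finite_set_times finite_set_plus)
        ultimately show ?thesis by (intro ln_mono) auto
      qed
      ultimately have "127 / 80 * ln (real n) \<le> ln (real (card (A * A + A * A)))"
        using n(2) lnC by argo
      moreover have "A \<noteq> {}" using n(3) by (auto simp: n_def)
      ultimately have "exp (127 / 80 * ln (real n)) \<le> real (card (A * A + A * A))"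
        using Qpos by (subst (asm) ln_ge_iff) auto
      then show ?thesis using False n(3) by (simp add: powr_def \<epsilon>_def n_def)
    qed
  qed
  ultimately show ?thesis by blast
qed

end
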